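(* Let $L>0$ and $\varrho\ge0$. Let $f:\mathbb{R}^n\to\mathbb{R}$ be a $\mathcal{C}^2$-smooth function whose gradient is Lipschitz continuous with constant $L$, let $g:\mathbb{R}^n\to(-\infty,\infty]$ be a proper, lower semicontinuous, $\varrho$-weakly convex function, and let $\varphi:=f+g$. Let $\{x^k\}$ be a sequence generated by the inexact proximal gradient method (described in the context) with $\varepsilon_1\le r_1$, $\theta\le\mu$, and $\rho_k=C\varepsilon_k^2$ for all $k\in\mathbb{N}$, where $$C=\min\Big\{\frac{C_1^2}{4C_2^2},\frac{C_1}{4}\Big\},\quad C_1:=\lambda\big(1-\lambda(L+\varrho)\big),\quad C_2:=2\Big(\sqrt{\tfrac{2}{\lambda^{-1}-\varrho}}+\sqrt{2\lambda}\Big).$$ Assume further that the set $\mathbb{N}\setminus\mathcal{N}$ of non-null iterations is infinite, that $\{x^k\}$ has an accumulation point $\bar x$, and that the function $\mathcal{F}_\lambda:\mathbb{R}^n\times\mathbb{R}\to\mathbb{R}$ defined in the context satisfies the KL property at $(\bar x,0)$. Then: (i) $\bar x$ is a stationary point of $\varphi$, and the sequence $\{x^k\}$ converges to $\bar x$ and has finite length, i.e., $\sum_{k=1}^\infty\|x^{k+1}-x^k\|<\infty$. (ii) If in addition the KL property of $\mathcal{F}_\lambda$ at $(\bar x,0)$ holds with $\psi(t)=Mt^{1-q}$ for some $M>0$ and $q\in(0,1)$, then, writing $\mathbb{N}\setminus\mathcal{N}=\{j_1<j_2<\cdots\}$ and $z^k:=x^{j_k}$ for all $k\in\mathbb{N}$,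 the following convergence rates are guaranteed for the sequence $\{z^k\}$: $\bullet$ If $q\in(0,1/2]$, the sequence $\{z^k\}$ converges linearly to $\bar x$. $\bullet$ If $q\in(1/2,1)$, there exists a positive constant $\gamma$ such that $\|z^k-\bar x\|\le\gamma k^{-\frac{1-q}{2q-1}}$ for all sufficiently large $k\in\mathbb{N}$.
   Context: $\mathbb{R}^n$ carries the Euclidean norm; $\mathbb{N}=\{1,2,\ldots\}$; $0^{-1}:=\infty$. $g$ is $\varrho$-weakly convex if $g(\cdot)+\frac{\varrho}{2}\|\cdot\|^2$ is convex. Stationary point of $\varphi$: $\bar x$ with $0\in\partial\varphi(\bar x)$, where $\partial\varphi$ is the limiting (Mordukhovich) subdifferential; here $\partial\varphi(\bar x)=\nabla f(\bar x)+\partial g(\bar x)$, and for weakly convex $g$ the set $\partial g(\bar x)$ coincides with the regular (Fréchet) subdifferential $\{v:\liminf_{x\to\bar x}\frac{g(x)-g(\bar x)-\langle v,x-\bar x\rangle}{\|x-\bar x\|}\ge0\}$, $\bar x\in\operatorname{dom} g$. Notation: $F_\lambda(x):=x-\lambda\nabla f(x)$ and $\Phi_{\lambda,z}(y):=g(y)+\frac{1}{2\lambda}\|y-z\|^2$. Inexact proximal gradient method. Parameters: $\lambda\in(0,(L+\varrho)^{-1})$, $x^1\in\mathbb{R}^n$, $\varepsilon_1,r_1>0$, $\mu,\theta\in(0,1)$, and a sequence $\{\rho_k\}\subset[0,\infty)$ (which may depend on $\varepsilon_k$). For each $k\in\mathbb{N}$: - choose any $p^k\in\mathbb{R}^n$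 with $\Phi_{\lambda,F_\lambda(x^k)}(p^k)\le\inf_{y\in\mathbb{R}^n}\Phi_{\lambda,F_\lambda(x^k)}(y)+\min\big\{\tfrac{\lambda(1-\lambda\varrho)\varepsilon_k^2}{2},\rho_k\big\}$, and put $g^k:=\lambda^{-1}(x^k-p^k)$; - if $\|g^k\|\le r_k+\varepsilon_k$, set $r_{k+1}:=\mu r_k$, $\varepsilon_{k+1}:=\theta\varepsilon_k$, $x^{k+1}:=x^k$; otherwise set $r_{k+1}:=r_k$, $\varepsilon_{k+1}:=\varepsilon_k$, $x^{k+1}:=p^k$. Null iterations: $\mathcal{N}:=\{k\in\mathbb{N}:x^{k+1}=x^k\}$ (equivalently, $\|g^k\|\le r_k+\varepsilon_k$). Forward-backward envelope: $\varphi_\lambda(x):=\inf_{y\in\mathbb{R}^n}\{f(x)+\langle\nabla f(x),y-x\rangle+\frac1{2\lambda}\|y-x\|^2+g(y)\}$, which is $\mathcal{C}^1$-smooth under the present assumptions. Define $\mathcal{F}_\lambda(x,\varepsilon):=\varphi_\lambda(x)+\mathscr{C}\varepsilon^2$ for $(x,\varepsilon)\in\mathbb{R}^n\times\mathbb{R}$, where $\mathscr{C}:=\min\big\{\frac{\lambda(1-\lambda\varrho)}{2},\frac{C_1^2}{4C_2^2},\frac{C_1}{4}\big\}$. KL property (for a $\mathcal{C}^1$-smooth $h$ on a Euclidean space) at $\bar y$: there exist $\eta\in(0,\infty]$, a neighborhood $U$ of $\bar y$, and a concave continuous $\psi:[0,\eta)\to[0,\infty)$ with $\psi(0)=0$,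 $\psi$ $\mathcal{C}^1$-smooth on $(0,\eta)$, $\psi'>0$ on $(0,\eta)$, such that $\psi'(h(y)-h(\bar y))\|\nabla h(y)\|\ge1$ for all $y\in U$ with $h(\bar y)<h(y)<h(\bar y)+\eta$. *)

theory Defs
  imports "HOL-Analysis.Analysis"
begin

subsection \<open>Smoothness\<close>

(* Meaningful only at points where h is differentiable. *)
definition gradient :: "('a::real_inner \<Rightarrow> real) \<Rightarrow> 'a \<Rightarrow> 'a" where
  "gradient h x = (THE D. GDERIV h x :> D)"

(* The second derivative is represented by the derivative H of the gradient, continuous
   with respect to the operator norm. *)
definition C2_smooth :: "('a::euclidean_space \<Rightarrow> real) \<Rightarrow> bool" where
  "C2_smooth h \<longleftrightarrow>
     (\<forall>x. h differentiable (at x)) \<and>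
     (\<exists>H :: 'a \<Rightarrow> 'a \<Rightarrow>\<^sub>L 'a.
        (\<forall>x. (gradient h has_derivative blinfun_apply (H x)) (at x)) \<and> continuous_on UNIV H)"

subsection \<open>Extended-real-valued functions\<close>

definition proper_fun :: "('a \<Rightarrow> ereal) \<Rightarrow> bool" where
  "proper_fun h \<longleftrightarrow> (\<forall>x. h x \<noteq> -\<infinity>) \<and> (\<exists>x. h x \<noteq> \<infinity>)"

definition lsc_fun :: "('a::topological_space \<Rightarrow> ereal) \<Rightarrow> bool" where
  "lsc_fun h \<longleftrightarrow> (\<forall>x. h x \<le> Liminf (at x) h)"

(* Intended for functions that do not take the value -\<infinity>. *)
definition convex_fun :: "('a::real_vector \<Rightarrow> ereal) \<Rightarrow> bool" where
  "convex_fun h \<longleftrightarrow>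
     (\<forall>x y. \<forall>t\<in>{0<..<1::real}.
        h ((1 - t) *\<^sub>R x + t *\<^sub>R y) \<le> ereal (1 - t) * h x + ereal t * h y)"

definition weakly_convex :: "real \<Rightarrow> ('a::real_normed_vector \<Rightarrow> ereal) \<Rightarrow> bool" where
  "weakly_convex \<rho> h \<longleftrightarrow> convex_fun (\<lambda>x. h x + ereal (\<rho> / 2 * (norm x)\<^sup>2))"

definition frechet_subdiff :: "('a::euclidean_space \<Rightarrow> ereal) \<Rightarrow> 'a \<Rightarrow> 'a set" where
  "frechet_subdiff h xb =
     {v. \<bar>h xb\<bar> \<noteq> \<infinity> \<and>
         0 \<le> Liminf (at xb) (\<lambda>x. (h x - h xb - ereal (v \<bullet> (x - xb))) / ereal (norm (x - xb)))}"

definition limiting_subdiff :: "('a::euclidean_space \<Rightarrow> ereal) \<Rightarrow> 'a \<Rightarrow> 'a set" where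
  "limiting_subdiff h xb =
     {v. \<bar>h xb\<bar> \<noteq> \<infinity> \<and>
         (\<exists>u w. u \<longlonglongrightarrow> xb \<and> (\<lambda>k. h (u k)) \<longlonglongrightarrow> h xb \<and>
                (\<forall>k. w k \<in> frechet_subdiff h (u k)) \<and> w \<longlonglongrightarrow> v)}"

definition stationary_point :: "('a::euclidean_space \<Rightarrow> ereal) \<Rightarrow> 'a \<Rightarrow> bool" where
  "stationary_point h xb \<longleftrightarrow> 0 \<in> limiting_subdiff h xb"

subsection \<open>The inexact proximal gradient method\<close>

definition fwd_step :: "('a::real_inner \<Rightarrow> real) \<Rightarrow> real \<Rightarrow> 'a \<Rightarrow> 'a" where
  "fwd_step f lam x = x - lam *\<^sub>R gradient f x"

definition prox_objective :: "('a::real_inner \<Rightarrow> ereal) \<Rightarrow> real \<Rightarrow> 'a \<Rightarrow> 'a \<Rightarrow> ereal" where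
  "prox_objective g lam z y = g y + ereal (1 / (2 * lam) * (norm (y - z))\<^sup>2)"

(* All sequences are indexed by k = 1, 2, ...; their values at index 0 are irrelevant. *)
definition inexact_prox_grad ::
    "('a::euclidean_space \<Rightarrow> real) \<Rightarrow> ('a \<Rightarrow> ereal) \<Rightarrow> real \<Rightarrow> real \<Rightarrow> real \<Rightarrow> real \<Rightarrow>
     (nat \<Rightarrow> real) \<Rightarrow> (nat \<Rightarrow> 'a) \<Rightarrow> (nat \<Rightarrow> 'a) \<Rightarrow> (nat \<Rightarrow> real) \<Rightarrow> (nat \<Rightarrow> real) \<Rightarrow> bool" where
  "inexact_prox_grad f g varrho lam \<mu> \<theta> rho x p \<epsilon> r \<longleftrightarrow>
     (\<forall>k\<ge>1.
        prox_objective g lam (fwd_step f lam (x k)) (p k)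
          \<le> (INF y. prox_objective g lam (fwd_step f lam (x k)) y)
             + ereal (min (lam * (1 - lam * varrho) * (\<epsilon> k)\<^sup>2 / 2) (rho k)) \<and>
        (if norm ((1 / lam) *\<^sub>R (x k - p k)) \<le> r k + \<epsilon> k
         then r (Suc k) = \<mu> * r k \<and> \<epsilon> (Suc k) = \<theta> * \<epsilon> k \<and> x (Suc k) = x k
         else r (Suc k) = r k \<and> \<epsilon> (Suc k) = \<epsilon> k \<and> x (Suc k) = p k))"

definition null_iterations :: "(nat \<Rightarrow> 'a) \<Rightarrow> nat set" where
  "null_iterations x = {k. 1 \<le> k \<and> x (Suc k) = x k}"

definition C1_const :: "real \<Rightarrow> real \<Rightarrow> real \<Rightarrow> real" where
  "C1_const L varrho lam = lam * (1 - lam * (L + varrho))"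

definition C2_const :: "real \<Rightarrow> real \<Rightarrow> real" where
  "C2_const varrho lam = 2 * (sqrt (2 / (1 / lam - varrho)) + sqrt (2 * lam))"

definition C_const :: "real \<Rightarrow> real \<Rightarrow> real \<Rightarrow> real" where
  "C_const L varrho lam =
     min ((C1_const L varrho lam)\<^sup>2 / (4 * (C2_const varrho lam)\<^sup>2)) (C1_const L varrho lam / 4)"

subsection \<open>Forward-backward envelope\<close>

definition fb_envelope ::
    "('a::real_inner \<Rightarrow> real) \<Rightarrow> ('a \<Rightarrow> ereal) \<Rightarrow> real \<Rightarrow> 'a \<Rightarrow> ereal" where
  "fb_envelope f g lam x =
     (INF y. ereal (f x + gradient f x \<bullet> (y - x) + 1 / (2 * lam) * (norm (y - x))\<^sup>2) + g y)"

definition script_C_const :: "real \<Rightarrow> real \<Rightarrow> real \<Rightarrow> real" where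
  "script_C_const L varrho lam =
     Min {lam * (1 - lam * varrho) / 2,
          (C1_const L varrho lam)\<^sup>2 / (4 * (C2_const varrho lam)\<^sup>2),
          C1_const L varrho lam / 4}"

(* The envelope is finite everywhere when g is proper, lsc and varrho-weakly convex and
   0 < lam < 1 / varrho, so real_of_ereal loses nothing there. *)
definition merit_fun ::
    "('a::real_inner \<Rightarrow> real) \<Rightarrow> ('a \<Rightarrow> ereal) \<Rightarrow> real \<Rightarrow> real \<Rightarrow> real \<Rightarrow> 'a \<times> real \<Rightarrow> real" where
  "merit_fun f g L varrho lam =
     (\<lambda>(x, e). real_of_ereal (fb_envelope f g lam x) + script_C_const L varrho lam * e\<^sup>2)"

subsection \<open>Kurdyka-Lojasiewicz property\<close>

definition KL_with :: "('b::euclidean_space \<Rightarrow> real) \<Rightarrow> 'b \<Rightarrow> (real \<Rightarrow> real) \<Rightarrow> bool" where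
  "KL_with h yb \<psi> \<longleftrightarrow>
     (\<exists>(\<eta>::ereal) U \<psi>'. 0 < \<eta> \<and> open U \<and> yb \<in> U \<and>
        concave_on {t. 0 \<le> t \<and> ereal t < \<eta>} \<psi> \<and>
        continuous_on {t. 0 \<le> t \<and> ereal t < \<eta>} \<psi> \<and>
        (\<forall>t. 0 \<le> t \<and> ereal t < \<eta> \<longrightarrow> 0 \<le> \<psi> t) \<and>
        \<psi> 0 = 0 \<and>
        (\<forall>t. 0 < t \<and> ereal t < \<eta> \<longrightarrow> (\<psi> has_real_derivative \<psi>' t) (at t) \<and> 0 < \<psi>' t) \<and>
        continuous_on {t. 0 < t \<and> ereal t < \<eta>} \<psi>' \<and>
        (\<forall>y\<in>U. h yb < h y \<and> ereal (h y) < ereal (h yb) + \<eta> \<longrightarrow>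
                1 \<le> \<psi>' (h y - h yb) * norm (gradient h y)))"

definition KL_property :: "('b::euclidean_space \<Rightarrow> real) \<Rightarrow> 'b \<Rightarrow> bool" where
  "KL_property h yb \<longleftrightarrow> (\<exists>\<psi>. KL_with h yb \<psi>)"

subsection \<open>Linear convergence\<close>

(* R-linear convergence, the usual meaning in rate results based on the KL property. *)
definition converges_linearly :: "(nat \<Rightarrow> 'a::real_normed_vector) \<Rightarrow> 'a \<Rightarrow> bool" where
  "converges_linearly z zb \<longleftrightarrow>
     (\<exists>\<gamma>>0. \<exists>\<tau>\<in>{0<..<1}. \<forall>\<^sub>F k in sequentially. norm (z k - zb) \<le> \<gamma> * \<tau> ^ k)"

end

theory Submission
  imports Defs
begin

text \<open>Let T x be the exact forward-backward point, the prox of g at the forward step. The envelope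
  equals f - lam / 2 * |grad f|^2 plus the Moreau envelope of g at the forward step, hence it is
  differentiable with gradient of norm at most (1 + lam L) / lam * |x - T x|. At a non-null
  iteration the residual exceeds 2 * epsilon, which absorbs the inexactness: the merit function
  F decreases by a multiple of the squared step, and its gradient is bounded by a multiple of the
  step. Null iterations do not move x and only shrink epsilon. The KL inequality and concavity of
  psi then bound each step by a difference of consecutive values of psi (F - F xbar), so the
  sequence is trapped near its accumulation point and has finite length. Infinitely many null
  iterations must occur, and along them x - T x tends to 0, so that xbar = T xbar. For
  psi t = M t^(1-q) the gap S at the non-null iterations satisfies
  S (k+1) \<le> S k - c S k^(2q), which gives the rates.\<close>

subsection \<open>Lower semicontinuity and existence of proximal points\<close>

text \<open>The two bounds in the tolerance have separate duties: the first keeps the computed point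
  within lam * epsilon of T x, the second, rho, keeps the loss of decrease below a fraction of the
  squared step. Both errors are measured in epsilon. Since theta <= mu preserves epsilon <= r, the
  threshold r + epsilon is at least 2 * epsilon, and this is why every step that moves dominates
  them. The order of the limits matters. Convergence of F has to precede epsilon -> 0, which is
  derived from it: if null iterations ceased, epsilon would freeze and F would fall by a fixed
  amount at every iteration. A lower bound for F that does not presuppose epsilon -> 0 comes from
  continuity of the envelope at the accumulation point. The gradient of the merit function at an
  iterate is controlled by the step that leaves it, not by the one that reached it. The KL
  inequality and the decrease can therefore be combined at one index, and the steps telescope
  without the usual arithmetic-geometric mean splitting.\<close>

lemma lsc_fun_eventually_less:
  assumes "lsc_fun h" and "c < h x"
  shows "\<forall>\<^sub>F y in nhds x. c < h y"
proof -
  have "\<forall>\<^sub>F y in at x. c < h y"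
    using assms by (auto simp: lsc_fun_def le_Liminf_iff)
  with assms(2) show ?thesis
    by (simp add: eventually_nhds_conv_at)
qed

lemma lsc_fun_add_continuous:
  fixes h :: "'a::t2_space \<Rightarrow> ereal"
  assumes h: "lsc_fun h" "\<And>x. h x \<noteq> -\<infinity>" and q: "continuous_on UNIV q"
  shows "lsc_fun (\<lambda>x. h x + ereal (q x))"
  unfolding lsc_fun_def le_Liminf_iff
proof (intro allI impI)
  fix x c assume c: "c < h x + ereal (q x)"
  show "\<forall>\<^sub>F y in at x. c < h y + ereal (q y)"
  proof (cases c)
    case (real c')
    have "ereal (c' - q x) < h x"
      using c real h(2)[of x] by (cases "h x") auto
    \<comment> \<open>A level d strictly between \<open>c' - q x\<close> and \<open>h x\<close>
      leaves one open condition for \<open>h\<close> and one for \<open>q\<close>.\<close>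
    then obtain d where d: "ereal (c' - q x) < ereal d" "ereal d < h x"
      using ereal_dense2 by blast
    have "\<forall>\<^sub>F y in nhds x. ereal d < h y"
      by (rule lsc_fun_eventually_less) (use h d in auto)
    hence 1: "\<forall>\<^sub>F y in at x. ereal d < h y"
      by (auto simp: eventually_at_filter elim: eventually_mono)
    have "(q \<longlongrightarrow> q x) (at x)"
      using q by (simp add: continuous_on_def)
    hence 2: "\<forall>\<^sub>F y in at x. c' - d < q y"
      by (rule order_tendstoD) (use d in auto)
    show ?thesis using 1 2
    proof eventually_elim
      case (elim y)
      thus ?case using real h(2)[of y] by (cases "h y") auto
    qed
  next
    case MInf
    show ?thesis by (rule always_eventually) (use MInf h(2) in \<open>auto simp: less_le\<close>)
  qed (use c in auto)
qed

text \<open>Weierstrass by a minimizing sequence: a level strictly between the infimum and the value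
  at the limit of a subsequence would contradict lower semicontinuity there.\<close>

lemma lsc_fun_attains_inf:
  fixes h :: "'a::metric_space \<Rightarrow> ereal"
  assumes h: "lsc_fun h" and K: "compact K" "K \<noteq> {}"
  shows "\<exists>x\<in>K. \<forall>y\<in>K. h x \<le> h y"
proof -
  obtain v where v: "\<And>n. v n \<in> h ` K" "v \<longlonglongrightarrow> Inf (h ` K)"
    using Inf_as_limit[of "h ` K"] K by auto
  have "\<forall>n. \<exists>u. u \<in> K \<and> h u = v n" using v(1) by (metis image_iff)
  then obtain u where u: "\<And>n. u n \<in> K" "\<And>n. h (u n) = v n" by metis
  obtain x s where xs: "x \<in> K" "strict_mono s" "(u \<circ> s) \<longlonglongrightarrow> x"
    using K(1) u(1) unfolding compact_def by metis
  have "h x \<le> Inf (h ` K)"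
  proof (rule ccontr)
    assume "\<not> ?thesis"
    then obtain d where d: "Inf (h ` K) < d" "d < h x"
      using dense not_le by metis
    have "\<forall>\<^sub>F n in sequentially. d < h (u (s n))"
      using lsc_fun_eventually_less[OF h d(2)] xs(3)
      by (auto simp: filterlim_iff o_def)
    moreover have "\<forall>\<^sub>F n in sequentially. v (s n) < d"
      using LIMSEQ_subseq_LIMSEQ[OF v(2) xs(2)] d(1) by (auto simp: o_def dest: order_tendstoD)
    ultimately have "\<forall>\<^sub>F n in sequentially. False"
      by eventually_elim (simp add: u(2))
    thus False by simp
  qed
  thus ?thesis using xs(1) by (meson INF_lower order_trans)
qed

text \<open>The last term is the exact gain over convexity. In \<open>obj_strongly_convex\<close> it
  appears once for the proximal quadratic and once, with opposite sign, for the weak convexity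
  shift.\<close>

lemma norm_sq_convex_comb:
  fixes x y :: "'a::real_inner"
  shows "(norm ((1 - t) *\<^sub>R x + t *\<^sub>R y))\<^sup>2 =
    (1 - t) * (norm x)\<^sup>2 + t * (norm y)\<^sup>2 - t * (1 - t) * (norm (x - y))\<^sup>2"
  unfolding power2_norm_eq_inner
  by (simp add: inner_add inner_diff inner_commute algebra_simps)

section \<open>Existence of proximal points of a weakly convex function\<close>

locale prox_setup =
  fixes g :: "'a::euclidean_space \<Rightarrow> ereal" and varrho lam :: real
  assumes proper: "proper_fun g" and lsc: "lsc_fun g" and wconv: "weakly_convex varrho g"
    and varrho_nonneg: "0 \<le> varrho" and lam_pos: "0 < lam" and lam_varrho: "lam * varrho < 1"
begin

definition dom :: "'a set" where "dom = {y. g y \<noteq> \<infinity>}"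

text \<open>Outside \<open>dom\<close> the conversion returns the default value 0, so
  \<open>gr\<close> carries information about \<open>g\<close> only on \<open>dom\<close>.\<close>

definition gr :: "'a \<Rightarrow> real" where "gr y = real_of_ereal (g y)"

text \<open>The strong convexity modulus of the proximal objective: the quadratic supplies
  \<open>1 / lam\<close>, weak convexity consumes \<open>varrho\<close>.\<close>

definition modulus :: real where "modulus = 1 / lam - varrho"

definition obj :: "'a \<Rightarrow> 'a \<Rightarrow> real" where
  "obj z y = gr y + (norm (y - z))\<^sup>2 / (2 * lam)"

lemma g_not_MInf [simp]: "g y \<noteq> -\<infinity>"
  using proper by (auto simp: proper_fun_def)

lemma g_eq: "y \<in> dom \<Longrightarrow> g y = ereal (gr y)"
  by (cases "g y") (auto simp: dom_def gr_def)

lemma g_notin: "y \<notin> dom \<Longrightarrow> g y = \<infinity>"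
  by (auto simp: dom_def)

lemma dom_nonempty: "dom \<noteq> {}"
  using proper by (auto simp: proper_fun_def dom_def)

lemma modulus_pos: "modulus > 0"
  using lam_pos lam_varrho by (simp add: modulus_def field_simps)

lemma prox_objective_eq: "y \<in> dom \<Longrightarrow> prox_objective g lam z y = ereal (obj z y)"
  by (simp add: prox_objective_def obj_def g_eq)

lemma prox_objective_notin: "y \<notin> dom \<Longrightarrow> prox_objective g lam z y = \<infinity>"
  by (simp add: prox_objective_def g_notin)

lemma wconv_real:
  assumes "x \<in> dom" "y \<in> dom" "0 < t" "t < 1"
  defines "w \<equiv> (1 - t) *\<^sub>R x + t *\<^sub>R y"
  shows "w \<in> dom"
    and "gr w + varrho / 2 * (norm w)\<^sup>2 \<le> (1 - t) * (gr x + varrho / 2 * (norm x)\<^sup>2) +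
           t * (gr y + varrho / 2 * (norm y)\<^sup>2)"
proof -
  have *: "g w + ereal (varrho / 2 * (norm w)\<^sup>2) \<le>
      ereal (1 - t) * (g x + ereal (varrho / 2 * (norm x)\<^sup>2)) +
      ereal t * (g y + ereal (varrho / 2 * (norm y)\<^sup>2))"
    using wconv assms(3,4) unfolding weakly_convex_def convex_fun_def w_def by auto
  have 1: "w \<in> dom"
  proof (rule ccontr)
    assume "w \<notin> dom"
    thus False using * assms(1,2) by (simp add: g_eq g_notin)
  qed
  show "w \<in> dom" by (rule 1)
  show "gr w + varrho / 2 * (norm w)\<^sup>2 \<le> (1 - t) * (gr x + varrho / 2 * (norm x)\<^sup>2) +
           t * (gr y + varrho / 2 * (norm y)\<^sup>2)"
    using * assms(1,2) 1 by (simp add: g_eq)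
qed

lemma obj_strongly_convex:
  assumes "x \<in> dom" "y \<in> dom" "0 < t" "t < 1"
  shows "obj z ((1 - t) *\<^sub>R x + t *\<^sub>R y) \<le>
    (1 - t) * obj z x + t * obj z y - modulus / 2 * t * (1 - t) * (norm (x - y))\<^sup>2"
proof -
  define w where "w = (1 - t) *\<^sub>R x + t *\<^sub>R y"
  define c where "c = varrho / 2"
  define s where "s = 1 / (2 * lam)"
  have modulus: "modulus / 2 = s - c" using lam_pos by (simp add: modulus_def s_def c_def field_simps)
  have obj: "obj z y = gr y + s * (norm (y - z))\<^sup>2" for y by (simp add: obj_def s_def)
  have 1: "(norm w)\<^sup>2 =
    (1 - t) * (norm x)\<^sup>2 + t * (norm y)\<^sup>2 - t * (1 - t) * (norm (x - y))\<^sup>2"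
    unfolding w_def by (rule norm_sq_convex_comb)
  have "w - z = (1 - t) *\<^sub>R (x - z) + t *\<^sub>R (y - z)"
    by (simp add: w_def algebra_simps)
  hence 2: "(norm (w - z))\<^sup>2 =
    (1 - t) * (norm (x - z))\<^sup>2 + t * (norm (y - z))\<^sup>2 - t * (1 - t) * (norm (x - y))\<^sup>2"
    using norm_sq_convex_comb[of t "x - z" "y - z"] by simp
  have "gr w + c * (norm w)\<^sup>2 \<le> (1 - t) * (gr x + c * (norm x)\<^sup>2) + t * (gr y + c * (norm y)\<^sup>2)"
    unfolding w_def c_def by (rule wconv_real(2)[OF assms])
  thus ?thesis unfolding w_def[symmetric] obj modulus 1 2 by (simp add: algebra_simps)
qed

text \<open>A convex function that is bounded below on a ball around \<open>y0\<close> can fall at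
  most linearly away from it. This plays the part of an affine minorant.\<close>

lemma gr_lower_bound:
  assumes y0: "y0 \<in> dom"
  shows "\<exists>a b. a \<ge> 0 \<and> (\<forall>y\<in>dom. gr y + varrho / 2 * (norm y)\<^sup>2 \<ge> b - a * norm (y - y0))"
proof -
  define G where "G y = gr y + varrho / 2 * (norm y)\<^sup>2" for y
  have "lsc_fun (\<lambda>y. g y + ereal (varrho / 2 * (norm y)\<^sup>2))"
    by (intro lsc_fun_add_continuous lsc g_not_MInf continuous_intros)
  hence "\<exists>x1\<in>cball y0 1. \<forall>y\<in>cball y0 1.
      g x1 + ereal (varrho / 2 * (norm x1)\<^sup>2) \<le> g y + ereal (varrho / 2 * (norm y)\<^sup>2)"
    by (rule lsc_fun_attains_inf) auto
  then obtain x1 where x1: "x1 \<in> cball y0 1" "\<And>y. y \<in> cball y0 1 \<Longrightarrow>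
      g x1 + ereal (varrho / 2 * (norm x1)\<^sup>2) \<le> g y + ereal (varrho / 2 * (norm y)\<^sup>2)"
    by blast
  have x1d: "x1 \<in> dom"
    using x1(2)[of y0] y0 by (auto simp: dom_def)
  have near: "G x1 \<le> G y" if "y \<in> dom" "norm (y - y0) \<le> 1" for y
    using x1(2)[of y] that x1d by (simp add: g_eq G_def dist_norm norm_minus_commute)
  \<comment> \<open>The largest drop below \<open>G y0\<close> within the unit ball; convexity turns
    it into a bound on the slope farther out.\<close>
  define a where "a = G y0 - G x1"
  have a: "a \<ge> 0" using near[OF y0] by (simp add: a_def)
  have "G x1 - a * norm (y - y0) \<le> G y" if y: "y \<in> dom" for y
  proof (cases "norm (y - y0) \<le> 1")
    case True
    thus ?thesis using near[OF y] a by (smt (verit) mult_nonneg_nonneg norm_ge_zero)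
  next
    case False
    define d where "d = norm (y - y0)"
    have d: "d > 1" using False by (simp add: d_def)
    \<comment> \<open>The point of the segment at distance 1 from \<open>y0\<close>, where the bound
      on the ball applies.\<close>
    define w where "w = (1 - 1/d) *\<^sub>R y0 + (1/d) *\<^sub>R y"
    have w: "w \<in> dom" "G w \<le> (1 - 1/d) * G y0 + (1/d) * G y"
      unfolding w_def G_def using wconv_real[OF y0 y, of "1/d"] d by auto
    have "w - y0 = (1/d) *\<^sub>R (y - y0)" by (simp add: w_def algebra_simps)
    hence "norm (w - y0) \<le> 1" using d by (simp add: d_def)
    hence "G x1 \<le> (1 - 1/d) * G y0 + (1/d) * G y" using near[OF w(1)] w(2) by linarith
    hence "d * G x1 \<le> (d - 1) * G y0 + G y" using d by (simp add: field_simps)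
    hence "G y \<ge> G y0 - d * a" by (simp add: a_def algebra_simps)
    thus ?thesis using a by (simp add: a_def d_def mult.commute)
  qed
  thus ?thesis using a unfolding G_def[symmetric] by blast
qed

text \<open>By \<open>gr_lower_bound\<close> the objective lies above a quadratic with leading
  coefficient \<open>modulus / 2\<close>, so its sublevel set at \<open>y0\<close> is bounded, and
  the minimum over a large ball is global.\<close>

lemma minimizer_exists: "\<exists>y\<in>dom. \<forall>w\<in>dom. obj z y \<le> obj z w"
proof -
  obtain y0 where y0: "y0 \<in> dom" using dom_nonempty by auto
  obtain b a where a: "a \<ge> 0" and lb: "\<And>y. y \<in> dom \<Longrightarrow> gr y + varrho / 2 * (norm y)\<^sup>2 \<ge> b - a * norm (y - y0)"
    using gr_lower_bound[OF y0] by auto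
  define v where "v = (1 / lam) *\<^sub>R (y0 - z) - varrho *\<^sub>R y0"
  define k where "k = (norm (y0 - z))\<^sup>2 / (2 * lam) - varrho / 2 * (norm y0)\<^sup>2"
  \<comment> \<open>Both quadratics are recentred at \<open>y0\<close>: there \<open>v\<close> is
    the gradient of their difference and \<open>k\<close> its value.\<close>
  have expand: "(norm (y - z))\<^sup>2 / (2 * lam) - varrho / 2 * (norm y)\<^sup>2 =
      modulus / 2 * (norm (y - y0))\<^sup>2 + v \<bullet> (y - y0) + k" for y
  proof -
    define c where "c = varrho / 2"
    define s where "s = 1 / (2 * lam)"
    have *: "modulus / 2 = s - c" "v = (2 * s) *\<^sub>R (y0 - z) - (2 * c) *\<^sub>R y0"
        "k = s * (norm (y0 - z))\<^sup>2 - c * (norm y0)\<^sup>2"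
        "(norm (y - z))\<^sup>2 / (2 * lam) - varrho / 2 * (norm y)\<^sup>2 = s * (norm (y - z))\<^sup>2 - c * (norm y)\<^sup>2"
      by (simp_all add: modulus_def v_def k_def s_def c_def diff_divide_distrib)
    show ?thesis unfolding *(4) unfolding *(1,2,3) unfolding power2_norm_eq_inner
      by (simp add: inner_diff_left inner_diff_right inner_commute algebra_simps)
  qed
  have low: "obj z y \<ge> b + k - (a + norm v) * norm (y - y0) + modulus / 2 * (norm (y - y0))\<^sup>2" if "y \<in> dom" for y
  proof -
    have "- (norm v * norm (y - y0)) \<le> v \<bullet> (y - y0)"
      using Cauchy_Schwarz_ineq2[of v "y - y0"] by linarith
    thus ?thesis using lb[OF that] expand[of y] by (simp add: obj_def algebra_simps)
  qed
  \<comment> \<open>Beyond radius 1 the constant term is at most its multiple by the distance, so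
    the quadratic has to beat linear terms only; the quotient is where it does.\<close>
  define R where "R = max 1 (2 * (a + norm v + \<bar>obj z y0 - b - k\<bar>) / modulus)"
  have far: "norm (y - y0) \<le> R" if y: "y \<in> dom" "obj z y \<le> obj z y0" for y
  proof (rule ccontr)
    assume R: "\<not> norm (y - y0) \<le> R"
    define d where "d = norm (y - y0)"
    have d: "d > 1" "d > 2 * (a + norm v + \<bar>obj z y0 - b - k\<bar>) / modulus"
      using R by (auto simp: R_def d_def)
    hence "modulus / 2 * d > a + norm v + \<bar>obj z y0 - b - k\<bar>"
      using modulus_pos by (simp add: field_simps)
    hence "modulus / 2 * d * d > (a + norm v + \<bar>obj z y0 - b - k\<bar>) * d"
      using d(1) by (intro mult_strict_right_mono) auto
    moreover have "\<bar>obj z y0 - b - k\<bar> * d \<ge> \<bar>obj z y0 - b - k\<bar>"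
      using d(1) by (simp add: mult_le_cancel_left1)
    ultimately have "modulus / 2 * d\<^sup>2 > (a + norm v) * d + (obj z y0 - b - k)"
      by (simp add: power2_eq_square algebra_simps)
    thus False using low[OF y(1)] y(2) by (simp add: d_def)
  qed
  have "lsc_fun (\<lambda>y. g y + ereal ((norm (y - z))\<^sup>2 / (2 * lam)))"
    using lam_pos by (intro lsc_fun_add_continuous lsc g_not_MInf continuous_intros) auto
  moreover have "compact (cball y0 R)" "cball y0 R \<noteq> {}" by (auto simp: R_def)
  ultimately obtain x where x: "x \<in> cball y0 R" "\<And>y. y \<in> cball y0 R \<Longrightarrow>
      g x + ereal ((norm (x - z))\<^sup>2 / (2 * lam)) \<le> g y + ereal ((norm (y - z))\<^sup>2 / (2 * lam))"
    using lsc_fun_attains_inf by meson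
  have y0R: "y0 \<in> cball y0 R" by (simp add: R_def)
  have xd: "x \<in> dom" using x(2)[OF y0R] y0 by (auto simp: dom_def)
  have near: "obj z x \<le> obj z y" if "y \<in> dom" "norm (y - y0) \<le> R" for y
    using x(2)[of y] that xd by (simp add: g_eq obj_def dist_norm norm_minus_commute)
  have "obj z x \<le> obj z y" if y: "y \<in> dom" for y
  proof (cases "norm (y - y0) \<le> R")
    case False
    hence "obj z y0 < obj z y" using far[OF y] by force
    moreover have "obj z x \<le> obj z y0" using near[OF y0] y0R by (simp add: R_def)
    ultimately show ?thesis by simp
  qed (use near y in blast)
  thus ?thesis using xd by blast
qed

end

subsection \<open>Gradients, the proximal map and the Moreau envelope\<close>

lemma gderiv_if_quadratic_error:
  assumes "\<And>w. \<bar>h w - h z - (w - z) \<bullet> v\<bar> \<le> K * (norm (w - z))\<^sup>2"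
  shows "GDERIV h z :> v"
  unfolding gderiv_def
proof (rule has_derivativeI_sandwich[where H = "\<lambda>w. K * norm (w - z)" and e = 1])
  show "bounded_linear (\<lambda>y. y \<bullet> v)" by (rule bounded_linear_inner_left)
  fix w assume "w \<noteq> z"
  thus "norm (h w - h z - (w - z) \<bullet> v) / norm (w - z) \<le> K * norm (w - z)"
    using assms[of w] by (simp add: field_simps power2_eq_square)
next
  have "((\<lambda>w. K * norm (w - z)) \<longlongrightarrow> K * norm (z - z)) (at z)"
    by (intro tendsto_intros)
  thus "((\<lambda>w. K * norm (w - z)) \<longlongrightarrow> 0) (at z)" by simp
qed auto

lemma gradient_eq: "GDERIV h x :> v \<Longrightarrow> gradient h x = v"
  unfolding gradient_def
proof (rule the_equality)
  fix w assume "GDERIV h x :> v" "GDERIV h x :> w"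
  hence "(\<lambda>h. h \<bullet> v) = (\<lambda>h. h \<bullet> w)"
    unfolding gderiv_def by (rule has_derivative_unique)
  hence "(w - v) \<bullet> v = (w - v) \<bullet> w" by (rule fun_cong)
  hence "(w - v) \<bullet> (w - v) = 0" by (simp add: inner_diff_right)
  thus "w = v" by simp
qed

lemma has_derivative_imp_gderiv:
  fixes h :: "'a::euclidean_space \<Rightarrow> real"
  assumes "(h has_derivative D) (at x)"
  obtains v where "GDERIV h x :> v" "\<And>y. D y = y \<bullet> v"
proof -
  have "linear D" using assms has_derivative_linear by blast
  hence *: "D y = y \<bullet> adjoint D 1" for y by (simp add: adjoint_works)
  hence "D = (\<lambda>y. y \<bullet> adjoint D 1)" by blast
  with assms have "GDERIV h x :> adjoint D 1" by (simp add: gderiv_def)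
  thus ?thesis using that * by blast
qed

lemma norm_gradient_le:
  fixes h :: "'a::euclidean_space \<Rightarrow> real"
  assumes "(h has_derivative D) (at x)" and "\<And>y. \<bar>D y\<bar> \<le> K * norm y"
  shows "norm (gradient h x) \<le> K"
proof -
  obtain v where v: "GDERIV h x :> v" "\<And>y. D y = y \<bullet> v"
    using has_derivative_imp_gderiv[OF assms(1)] by blast
  have "norm v * norm v \<le> K * norm v"
    using assms(2)[of v] v(2)[of v] by (simp add: power2_norm_eq_inner flip: power2_eq_square)
  \<comment> \<open>For v = 0 the previous inequality says nothing about \<open>K\<close>; testing
    the bound on a basis vector does.\<close>
  moreover have "0 \<le> K" if "v = 0"
  proof -
    obtain b :: 'a where "b \<in> Basis" by (meson nonempty_Basis ex_in_conv)
    thus ?thesis using assms(2)[of b] by auto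
  qed
  ultimately have "norm v \<le> K" by (cases "v = 0") auto
  thus ?thesis using gradient_eq[OF v(1)] by simp
qed

lemma gderiv_gradient:
  fixes h :: "'a::euclidean_space \<Rightarrow> real"
  shows "h differentiable (at x) \<Longrightarrow> GDERIV h x :> gradient h x"
  by (metis differentiable_def gradient_eq has_derivative_imp_gderiv)

text \<open>Difference quotients along a line through x are bounded by \<open>L * norm h\<close>,
  and their distance to \<open>D h\<close> tends to 0. Applied to the gradient of f, this bounds its
  second derivative by \<open>L\<close>.\<close>

lemma has_derivative_lipschitz_bound:
  fixes G :: "'a::real_normed_vector \<Rightarrow> 'b::real_normed_vector"
  assumes D: "(G has_derivative D) (at x)" and lip: "\<And>y. norm (G y - G x) \<le> L * norm (y - x)"
  shows "norm (D h) \<le> L * norm h"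
proof -
  have "((\<lambda>t::real. x + t *\<^sub>R h) has_derivative (\<lambda>t. t *\<^sub>R h)) (at 0)"
    by (auto intro!: derivative_eq_intros)
  moreover have "(G has_derivative D) (at (x + 0 *\<^sub>R h))" using D by simp
  ultimately have "((\<lambda>t::real. G (x + t *\<^sub>R h)) has_derivative (\<lambda>t. D (t *\<^sub>R h))) (at 0)"
    by (rule has_derivative_compose)
  moreover have "D (t *\<^sub>R h) = t *\<^sub>R D h" for t
    using has_derivative_linear[OF D] by (simp add: linear_cmul)
  ultimately have "((\<lambda>t. norm (G (x + t *\<^sub>R h) - G x - t *\<^sub>R D h) / \<bar>t\<bar>) \<longlongrightarrow> 0) (at 0)"
    by (simp add: has_derivative_iff_norm)
  hence lim: "((\<lambda>t. L * norm h + norm (G (x + t *\<^sub>R h) - G x - t *\<^sub>R D h) / \<bar>t\<bar>) \<longlongrightarrow> L * norm h + 0) (at 0)"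
    by (intro tendsto_intros)
  have "norm (D h) \<le> L * norm h + norm (G (x + t *\<^sub>R h) - G x - t *\<^sub>R D h) / \<bar>t\<bar>" if "t \<noteq> 0" for t
  proof -
    have "\<bar>t\<bar> * norm (D h) = norm (t *\<^sub>R D h)" by simp
    also have "\<dots> \<le> norm (G (x + t *\<^sub>R h) - G x) + norm (G (x + t *\<^sub>R h) - G x - t *\<^sub>R D h)"
      using norm_triangle_ineq4[of "G (x + t *\<^sub>R h) - G x" "G (x + t *\<^sub>R h) - G x - t *\<^sub>R D h"] by simp
    also have "norm (G (x + t *\<^sub>R h) - G x) \<le> L * (\<bar>t\<bar> * norm h)"
      using lip[of "x + t *\<^sub>R h"] by simp
    finally show ?thesis using that by (simp add: field_simps)
  qed
  hence "\<forall>\<^sub>F t in at 0. norm (D h) \<le> L * norm h + norm (G (x + t *\<^sub>R h) - G x - t *\<^sub>R D h) / \<bar>t\<bar>"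
    by (simp add: eventually_at_filter)
  thus ?thesis using tendsto_lowerbound[OF lim] by simp
qed

lemma descent_lemma:
  fixes h :: "'a::real_inner \<Rightarrow> real"
  assumes D: "\<And>x. GDERIV h x :> G x" and lip: "\<And>x y. norm (G x - G y) \<le> L * norm (x - y)"
  shows "h y \<le> h x + G x \<bullet> (y - x) + L / 2 * (norm (y - x))\<^sup>2"
proof -
  define d where "d = y - x"
  \<comment> \<open>The restriction to the segment minus the claimed quadratic bound; the Lipschitz
    condition makes its derivative nonpositive.\<close>
  define \<phi> where "\<phi> t = h (x + t *\<^sub>R d) - t * (G x \<bullet> d) - L / 2 * t\<^sup>2 * (norm d)\<^sup>2" for t
  have "\<phi> 1 \<le> \<phi> 0"
  proof (rule DERIV_nonpos_imp_nonincreasing[of 0 1 \<phi>])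
    fix t :: real assume t: "0 \<le> t" "t \<le> 1"
    have "((\<lambda>t::real. x + t *\<^sub>R d) has_derivative (\<lambda>t. t *\<^sub>R d)) (at t)"
      by (auto intro!: derivative_eq_intros)
    moreover have "(h has_derivative (\<lambda>v. v \<bullet> G (x + t *\<^sub>R d))) (at (x + t *\<^sub>R d))"
      using D by (simp add: gderiv_def)
    ultimately have "((\<lambda>t. h (x + t *\<^sub>R d)) has_derivative (\<lambda>s. (s *\<^sub>R d) \<bullet> G (x + t *\<^sub>R d))) (at t)"
      by (rule has_derivative_compose)
    hence "((\<lambda>t. h (x + t *\<^sub>R d)) has_real_derivative (d \<bullet> G (x + t *\<^sub>R d))) (at t)"
      by (rule has_derivative_imp_has_field_derivative) simp
    hence "(\<phi> has_real_derivative (d \<bullet> G (x + t *\<^sub>R d) - G x \<bullet> d - L * t * (norm d)\<^sup>2)) (at t)"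
      unfolding \<phi>_def by (auto intro!: derivative_eq_intros)
    moreover have "d \<bullet> G (x + t *\<^sub>R d) - G x \<bullet> d = d \<bullet> (G (x + t *\<^sub>R d) - G x)"
      by (simp add: inner_diff_right inner_commute)
    moreover have "d \<bullet> (G (x + t *\<^sub>R d) - G x) \<le> norm d * norm (G (x + t *\<^sub>R d) - G x)"
      by (rule norm_cauchy_schwarz)
    moreover have "norm d * norm (G (x + t *\<^sub>R d) - G x) \<le> norm d * (L * (t * norm d))"
      using lip[of "x + t *\<^sub>R d" x] t by (intro mult_left_mono) auto
    moreover have "norm d * (L * (t * norm d)) = L * t * (norm d)\<^sup>2"
      by (simp add: power2_eq_square)
    ultimately show "\<exists>z. (\<phi> has_real_derivative z) (at t) \<and> z \<le> 0"
      by (intro exI[of _ "d \<bullet> G (x + t *\<^sub>R d) - G x \<bullet> d - L * t * (norm d)\<^sup>2"] conjI) linarith+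
  qed simp
  thus ?thesis by (simp add: \<phi>_def d_def)
qed

section \<open>The proximal map and differentiability of the Moreau envelope\<close>

context prox_setup
begin

text \<open>The choice is harmless: \<open>prx_growth\<close> forces the minimizer to be
  unique.\<close>

definition prx :: "'a \<Rightarrow> 'a" where
  "prx z = (SOME y. y \<in> dom \<and> (\<forall>w\<in>dom. obj z y \<le> obj z w))"

lemma prx_in_dom [simp]: "prx z \<in> dom" and prx_le: "w \<in> dom \<Longrightarrow> obj z (prx z) \<le> obj z w"
  using someI_ex[of "\<lambda>y. y \<in> dom \<and> (\<forall>w\<in>dom. obj z y \<le> obj z w)"] minimizer_exists[of z]
  unfolding prx_def by blast+

text \<open>Strong convexity is tested at a point a fraction s of the way from the minimizer to w;
  dividing by s and letting s tend to 0 gives the growth.\<close>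

lemma prx_growth:
  assumes w: "w \<in> dom"
  shows "obj z (prx z) + modulus / 2 * (norm (w - prx z))\<^sup>2 \<le> obj z w"
proof -
  \<comment> \<open>The factor t stands for 1 - s, so that \<open>field_le_mult_one_interval\<close>
    performs the limit.\<close>
  have "t * (modulus / 2 * (norm (w - prx z))\<^sup>2) \<le> obj z w - obj z (prx z)" if t: "0 < t" "t < 1" for t
  proof -
    define s where "s = 1 - t"
    have s: "0 < s" "s < 1" using t by (auto simp: s_def)
    have "(1 - s) *\<^sub>R prx z + s *\<^sub>R w \<in> dom"
      using s w by (intro wconv_real) auto
    hence "obj z (prx z) \<le> obj z ((1 - s) *\<^sub>R prx z + s *\<^sub>R w)" by (rule prx_le)
    also have "\<dots> \<le> (1 - s) * obj z (prx z) + s * obj z w - modulus / 2 * s * (1 - s) * (norm (prx z - w))\<^sup>2"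
      using s w by (intro obj_strongly_convex) auto
    finally have "s * ((1 - s) * (modulus / 2 * (norm (prx z - w))\<^sup>2)) \<le> s * (obj z w - obj z (prx z))"
      by (simp add: algebra_simps)
    thus ?thesis using s(1) by (simp add: s_def norm_minus_commute)
  qed
  hence "modulus / 2 * (norm (w - prx z))\<^sup>2 \<le> obj z w - obj z (prx z)"
    by (rule field_le_mult_one_interval)
  thus ?thesis by simp
qed

lemma INF_prox_objective: "(INF y. prox_objective g lam z y) = ereal (obj z (prx z))"
proof (rule antisym)
  show "(INF y. prox_objective g lam z y) \<le> ereal (obj z (prx z))"
    by (rule INF_lower2[of "prx z"]) (auto simp: prox_objective_eq)
  have "ereal (obj z (prx z)) \<le> prox_objective g lam z y" for y
    by (cases "y \<in> dom") (auto simp: prox_objective_eq prox_objective_notin prx_le)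
  thus "ereal (obj z (prx z)) \<le> (INF y. prox_objective g lam z y)"
    by (intro INF_greatest)
qed

lemma inexact_prox_dist:
  assumes p: "prox_objective g lam z p \<le> (INF y. prox_objective g lam z y) + ereal \<delta>"
  shows "p \<in> dom" and "obj z p \<le> obj z (prx z) + \<delta>"
    and "modulus / 2 * (norm (p - prx z))\<^sup>2 \<le> \<delta>"
proof -
  show d: "p \<in> dom"
  proof (rule ccontr)
    assume "p \<notin> dom"
    thus False using p by (simp add: INF_prox_objective prox_objective_notin)
  qed
  show o: "obj z p \<le> obj z (prx z) + \<delta>"
    using p d by (simp add: INF_prox_objective prox_objective_eq)
  show "modulus / 2 * (norm (p - prx z))\<^sup>2 \<le> \<delta>"
    using prx_growth[OF d, of z] o by simp
qed

text \<open>Moving the centre cancels \<open>gr y\<close> and leaves an expression affine in y. Both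
  the Lipschitz bound and the derivative of the Moreau envelope rest on this.\<close>

lemma obj_diff: "obj w y - obj z y = ((z - y) \<bullet> (w - z)) / lam + (norm (w - z))\<^sup>2 / (2 * lam)"
proof -
  have "(norm (y - w))\<^sup>2 = (norm (y - z))\<^sup>2 + 2 * ((z - y) \<bullet> (w - z)) + (norm (w - z))\<^sup>2"
    unfolding power2_norm_eq_inner by (simp add: inner_diff inner_commute)
  thus ?thesis using lam_pos by (simp add: obj_def field_simps)
qed

text \<open>The growth inequalities of the two objectives, each tested at the minimizer of the
  other, are added; by \<open>obj_diff\<close> only an inner product with \<open>z - w\<close>
  survives.\<close>

lemma prx_lipschitz: "norm (prx z - prx w) \<le> norm (z - w) / (lam * modulus)"
proof -
  define d where "d = prx z - prx w"
  have "modulus / 2 * (norm d)\<^sup>2 \<le> obj z (prx w) - obj z (prx z)"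
    using prx_growth[of "prx w" z] by (simp add: d_def norm_minus_commute)
  moreover have "modulus / 2 * (norm d)\<^sup>2 \<le> obj w (prx z) - obj w (prx w)"
    using prx_growth[of "prx z" w] by (simp add: d_def)
  ultimately have "modulus * (norm d)\<^sup>2 \<le> (obj w (prx z) - obj z (prx z)) - (obj w (prx w) - obj z (prx w))"
    by simp
  also have "\<dots> = (d \<bullet> (z - w)) / lam"
    unfolding obj_diff d_def using lam_pos by (simp add: inner_diff inner_commute field_simps)
  also have "\<dots> \<le> (norm d * norm (z - w)) / lam"
    using lam_pos by (intro divide_right_mono norm_cauchy_schwarz) auto
  finally have *: "norm d * (lam * modulus * norm d) \<le> norm d * norm (z - w)"
    using lam_pos by (simp add: field_simps power2_eq_square)
  have "lam * modulus * norm d \<le> norm (z - w)"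
  proof (cases "d = 0")
    case False
    with * show ?thesis by (simp add: mult_le_cancel_left_pos)
  qed simp
  thus ?thesis using lam_pos modulus_pos by (simp add: d_def field_simps)
qed

definition moreau :: "'a \<Rightarrow> real" where "moreau z = obj z (prx z)"

text \<open>Testing the objective of w at \<open>prx z\<close> bounds the increment from above,
  testing that of z at \<open>prx w\<close> bounds it from below. The two linear parts differ by a
  second-order term because \<open>prx\<close> is Lipschitz.\<close>

lemma GDERIV_moreau: "GDERIV moreau z :> (1 / lam) *\<^sub>R (z - prx z)"
proof (rule gderiv_if_quadratic_error)
  fix w
  \<comment> \<open>The first summand pays for replacing \<open>w - prx w\<close> by
    \<open>z - prx z\<close>, the second is the quadratic of \<open>obj_diff\<close>.\<close>
  define K where "K = (1 + 1 / (lam * modulus)) / lam + 1 / (2 * lam)"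
  define I where "I = (w - z) \<bullet> (1 / lam) *\<^sub>R (z - prx z)"
  have K1: "1 / (2 * lam) \<le> K" using lam_pos modulus_pos by (simp add: K_def)
  have "moreau w - moreau z \<le> obj w (prx z) - obj z (prx z)"
    using prx_le[of "prx z" w] by (simp add: moreau_def)
  also have "\<dots> = I + 1 / (2 * lam) * (norm (w - z))\<^sup>2"
    unfolding obj_diff I_def by (simp add: inner_commute)
  also have "\<dots> \<le> I + K * (norm (w - z))\<^sup>2" using K1 by (intro add_left_mono mult_right_mono) auto
  finally have 1: "moreau w - moreau z - I \<le> K * (norm (w - z))\<^sup>2" by simp
  have "moreau z - moreau w \<le> obj z (prx w) - obj w (prx w)"
    using prx_le[of "prx w" z] by (simp add: moreau_def)
  also have "\<dots> = - I + (((z - w) + (prx w - prx z)) \<bullet> (w - z)) / lam + 1 / (2 * lam) * (norm (w - z))\<^sup>2"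
    unfolding obj_diff I_def using lam_pos
    by (simp add: inner_diff inner_add inner_commute norm_minus_commute field_simps)
  also have "(((z - w) + (prx w - prx z)) \<bullet> (w - z)) / lam \<le> (1 + 1 / (lam * modulus)) / lam * (norm (w - z))\<^sup>2"
  proof -
    have "((z - w) + (prx w - prx z)) \<bullet> (w - z) \<le> norm ((z - w) + (prx w - prx z)) * norm (w - z)"
      by (rule norm_cauchy_schwarz)
    also have "norm ((z - w) + (prx w - prx z)) \<le> norm (w - z) + norm (w - z) / (lam * modulus)"
      using prx_lipschitz[of w z] norm_triangle_ineq[of "z - w" "prx w - prx z"] by (simp add: norm_minus_commute)
    finally have "((z - w) + (prx w - prx z)) \<bullet> (w - z) \<le> (norm (w - z) + norm (w - z) / (lam * modulus)) * norm (w - z)"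
      by (simp add: mult_right_mono)
    also have "\<dots> = (1 + 1 / (lam * modulus)) * (norm (w - z))\<^sup>2"
      by (simp add: power2_eq_square distrib_right)
    finally show ?thesis using lam_pos by (simp add: divide_right_mono)
  qed
  finally have 2: "moreau z - moreau w + I \<le> K * (norm (w - z))\<^sup>2"
    by (simp add: K_def distrib_right)
  show "\<bar>moreau w - moreau z - (w - z) \<bullet> (1 / lam) *\<^sub>R (z - prx z)\<bar> \<le> ((1 + 1 / (lam * modulus)) / lam + 1 / (2 * lam)) * (norm (w - z))\<^sup>2"
    using 1 2 unfolding I_def K_def by linarith
qed

end

subsection \<open>Kurdyka-Lojasiewicz descent\<close>

text \<open>The bound \<eta> may be infinite; every condition restricts to a real \<open>e0\<close>
  strictly between 0 and \<eta>, and extended reals disappear from here on.\<close>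

lemma KL_with_realD:
  assumes "KL_with h yb \<psi>"
  shows "\<exists>(e0::real) U \<psi>'. e0 > 0 \<and> open U \<and> yb \<in> U \<and> concave_on {0..<e0} \<psi> \<and>
    continuous_on {0..<e0} \<psi> \<and> (\<forall>t. 0 \<le> t \<and> t < e0 \<longrightarrow> 0 \<le> \<psi> t) \<and> \<psi> 0 = 0 \<and>
    (\<forall>t. 0 < t \<and> t < e0 \<longrightarrow> (\<psi> has_real_derivative \<psi>' t) (at t) \<and> 0 < \<psi>' t) \<and>
    (\<forall>y\<in>U. h yb < h y \<and> h y < h yb + e0 \<longrightarrow> 1 \<le> \<psi>' (h y - h yb) * norm (gradient h y))"
proof -
  obtain \<eta> U \<psi>' where *: "(0::ereal) < \<eta>" "open U" "yb \<in> U"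
        "concave_on {t. 0 \<le> t \<and> ereal t < \<eta>} \<psi>"
        "continuous_on {t. 0 \<le> t \<and> ereal t < \<eta>} \<psi>"
        "\<forall>t. 0 \<le> t \<and> ereal t < \<eta> \<longrightarrow> 0 \<le> \<psi> t"
        "\<psi> 0 = 0"
        "\<forall>t. 0 < t \<and> ereal t < \<eta> \<longrightarrow> (\<psi> has_real_derivative \<psi>' t) (at t) \<and> 0 < \<psi>' t"
        "\<forall>y\<in>U. h yb < h y \<and> ereal (h y) < ereal (h yb) + \<eta> \<longrightarrow>
                1 \<le> \<psi>' (h y - h yb) * norm (gradient h y)"
    using assms unfolding KL_with_def by blast
  obtain e0 where e0: "ereal 0 < ereal e0" "ereal e0 < \<eta>"
    using ereal_dense2[OF *(1)] by (auto simp: zero_ereal_def)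
  have lt: "ereal t < \<eta>" if "t < e0" for t
    using that e0(2) by (meson less_ereal.simps(1) less_trans)
  have sub: "{0..<e0} \<subseteq> {t. 0 \<le> t \<and> ereal t < \<eta>}" using lt by auto
  have upper: "ereal (h y) < ereal (h yb) + \<eta>" if "h y < h yb + e0" for y
    using lt[of "h y - h yb"] that by (cases \<eta>) auto
  show ?thesis
  proof (intro exI[of _ e0] exI[of _ U] exI[of _ \<psi>'] conjI)
    show "concave_on {0..<e0} \<psi>"
      using convex_on_subset[OF *(4)[unfolded concave_on_def] sub] by (simp add: concave_on_def)
    show "continuous_on {0..<e0} \<psi>" using *(5) sub continuous_on_subset by blast
    show "\<forall>t. 0 \<le> t \<and> t < e0 \<longrightarrow> 0 \<le> \<psi> t" using *(6) lt by blast
    show "\<forall>t. 0 < t \<and> t < e0 \<longrightarrow> (\<psi> has_real_derivative \<psi>' t) (at t) \<and> 0 < \<psi>' t"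
      using *(8) lt by blast
    show "\<forall>y\<in>U. h yb < h y \<and> h y < h yb + e0 \<longrightarrow> 1 \<le> \<psi>' (h y - h yb) * norm (gradient h y)"
      using *(9) upper by blast
  qed (use * e0 in auto)
qed

lemma concave_on_below_tangent:
  fixes \<psi> :: "real \<Rightarrow> real"
  assumes c: "concave_on {0..<e} \<psi>" and s: "0 < s" "s < e" and t: "0 \<le> t" "t < e"
    and D: "(\<psi> has_real_derivative D) (at s)"
  shows "\<psi> s - \<psi> t \<ge> D * (s - t)"
proof -
  have "((\<lambda>x. - \<psi> x) has_real_derivative (- D)) (at s within {0..<e})"
    using DERIV_subset[OF DERIV_minus[OF D]] by simp
  hence "- \<psi> t - - \<psi> s \<ge> - D * (t - s)"
    using c s t unfolding concave_on_def
    by (intro convex_on_imp_above_tangent[of "{0..<e}"]) (auto simp: interior_atLeastLessThan)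
  thus ?thesis by (simp add: algebra_simps)
qed

lemma telescoping_norm_le:
  fixes x :: "nat \<Rightarrow> 'a::real_normed_vector"
  assumes "\<And>k. m \<le> k \<Longrightarrow> k < n \<Longrightarrow> norm (x (Suc k) - x k) \<le> S k - S (Suc k)" and "m \<le> n"
  shows "norm (x n - x m) \<le> S m - S n"
  using assms(2,1)
proof (induction n rule: dec_induct)
  case (step n)
  have "norm (x (Suc n) - x m) \<le> norm (x (Suc n) - x n) + norm (x n - x m)"
    using norm_triangle_ineq[of "x (Suc n) - x n" "x n - x m"] by simp
  also have "norm (x (Suc n) - x n) \<le> S n - S (Suc n)" using step by auto
  also have "norm (x n - x m) \<le> S m - S n" using step by auto
  finally show ?case by simp
qed auto

text \<open>The step bound is known only inside a ball. From an index with both \<open>x\<close>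
  within \<delta> / 2 of \<open>xb\<close> and \<open>S\<close> below \<delta> / 2, the total
  movement stays below \<delta> / 2, so by induction the sequence never leaves the ball.\<close>

lemma telescoping_trap:
  fixes x :: "nat \<Rightarrow> 'a::real_normed_vector"
  assumes step: "\<And>k. K \<le> k \<Longrightarrow> dist (x k) xb < \<delta> \<Longrightarrow> norm (x (Suc k) - x k) \<le> S k - S (Suc k)"
    and S: "\<And>k. K \<le> k \<Longrightarrow> 0 \<le> S k" "S \<longlonglongrightarrow> 0"
    and acc: "strict_mono s" "(x \<circ> s) \<longlonglongrightarrow> xb" and "\<delta> > 0"
  obtains N where "K \<le> N" "\<And>k. N \<le> k \<Longrightarrow> norm (x (Suc k) - x k) \<le> S k - S (Suc k)"
proof -
  have "\<forall>\<^sub>F i in sequentially. K \<le> s i"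
    by (rule eventually_sequentiallyI[of K]) (use seq_suble[OF acc(1)] order_trans in blast)
  moreover have "\<forall>\<^sub>F i in sequentially. dist (x (s i)) xb < \<delta> / 2"
    using tendstoD[OF acc(2), of "\<delta> / 2"] \<open>\<delta> > 0\<close> by (simp add: o_def)
  moreover have "\<forall>\<^sub>F i in sequentially. S (s i) < \<delta> / 2"
    using order_tendstoD(2)[OF LIMSEQ_subseq_LIMSEQ[OF S(2) acc(1)], of "\<delta> / 2"] \<open>\<delta> > 0\<close>
    by (simp add: o_def)
  ultimately have "\<forall>\<^sub>F i in sequentially. K \<le> s i \<and> dist (x (s i)) xb < \<delta> / 2 \<and> S (s i) < \<delta> / 2"
    by eventually_elim auto
  then obtain N where N: "K \<le> N" "dist (x N) xb < \<delta> / 2" "S N < \<delta> / 2"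
    by (auto simp: eventually_at_top_linorder)
  have *: "dist (x k) xb < \<delta>" if "N \<le> k" for k
    using that
  proof (induction k rule: less_induct)
    case (less k)
    have "norm (x k - x N) \<le> S N - S k"
      by (rule telescoping_norm_le) (use less N(1) in \<open>auto intro: step\<close>)
    also have "\<dots> < \<delta> / 2" using N S(1)[of k] less.prems by auto
    finally have "dist (x k) (x N) < \<delta> / 2" by (simp add: dist_norm)
    thus ?case using dist_triangle[of "x k" xb "x N"] N(2) by linarith
  qed
  show ?thesis using N(1) step * by (intro that[of N]) auto
qed

text \<open>All movement after index k is at most \<open>S k\<close>. Following the subsequence to
  its limit turns this into a bound on the distance to \<open>xb\<close>, which later yields the
  rates.\<close>

lemma telescoping_converges:
  fixes x :: "nat \<Rightarrow> 'a::real_normed_vector"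
  assumes step: "\<And>k. N \<le> k \<Longrightarrow> norm (x (Suc k) - x k) \<le> S k - S (Suc k)"
    and S: "\<And>k. N \<le> k \<Longrightarrow> 0 \<le> S k" "S \<longlonglongrightarrow> 0"
    and acc: "strict_mono s" "(x \<circ> s) \<longlonglongrightarrow> xb"
  shows "\<And>k. N \<le> k \<Longrightarrow> norm (x k - xb) \<le> S k" and "x \<longlonglongrightarrow> xb"
    and "summable (\<lambda>k. norm (x (Suc k) - x k))"
proof -
  have bound: "norm (x m - x n) \<le> S n" if "N \<le> n" "n \<le> m" for m n
    using telescoping_norm_le[of n m x S] step S(1)[of m] that by force
  show 1: "norm (x k - xb) \<le> S k" if k: "N \<le> k" for k
  proof -
    have "(\<lambda>i. norm (x (s i) - x k)) \<longlonglongrightarrow> norm (xb - x k)"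
      using acc(2) by (intro tendsto_intros) (simp add: o_def)
    moreover have "\<forall>\<^sub>F i in sequentially. norm (x (s i) - x k) \<le> S k"
      by (rule eventually_sequentiallyI[of k])
         (use bound[OF k] seq_suble[OF acc(1)] order_trans in blast)
    ultimately have "norm (xb - x k) \<le> S k"
      by (rule tendsto_upperbound) auto
    thus ?thesis by (simp add: norm_minus_commute)
  qed
  have "(\<lambda>k. x k - xb) \<longlonglongrightarrow> 0"
    by (rule Lim_null_comparison[OF _ S(2)]) (use 1 in \<open>auto simp: eventually_at_top_linorder\<close>)
  thus "x \<longlonglongrightarrow> xb" by (rule LIM_zero_cancel)
  have "(\<Sum>i<n. norm (x (Suc (i + N)) - x (i + N))) \<le> S N" for n
  proof -
    have "(\<Sum>i<n. norm (x (Suc (i + N)) - x (i + N))) \<le> (\<Sum>i<n. S (i + N) - S (Suc i + N))"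
      using step by (intro sum_mono) auto
    also have "\<dots> = S (0 + N) - S (n + N)" by (rule sum_lessThan_telescope')
    finally show ?thesis using S(1)[of "n + N"] by simp
  qed
  hence "summable (\<lambda>i. norm (x (Suc (i + N)) - x (i + N)))"
    by (intro summableI_nonneg_bounded) auto
  thus "summable (\<lambda>k. norm (x (Suc k) - x k))"
    using summable_iff_shift[of "\<lambda>k. norm (x (Suc k) - x k)" N] by simp
qed

section \<open>Abstract descent under the KL inequality\<close>

locale KL_descent =
  fixes h :: "'a::euclidean_space \<times> real \<Rightarrow> real" and x :: "nat \<Rightarrow> 'a" and e E :: "nat \<Rightarrow> real"
    and xb :: 'a and a b :: real
  assumes E_def: "\<And>k. E k = h (x k, e k) - h (xb, 0)"
    and E_pos: "\<And>k. 1 \<le> k \<Longrightarrow> 0 < E k" and E_lim: "E \<longlonglongrightarrow> 0"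
    and e_lim: "e \<longlonglongrightarrow> 0"
    and a: "a > 0" and b: "b > 0"
    and decrease: "\<And>k. 1 \<le> k \<Longrightarrow> a * (norm (x (Suc k) - x k))\<^sup>2 \<le> E k - E (Suc k)"
    and gradient_bound: "\<And>k. 1 \<le> k \<Longrightarrow> x (Suc k) \<noteq> x k \<Longrightarrow>
      norm (gradient h (x k, e k)) \<le> b * norm (x (Suc k) - x k)"
begin

lemma E_Suc_le: "1 \<le> k \<Longrightarrow> E (Suc k) \<le> E k"
  using decrease[of k] a by (smt (verit) mult_nonneg_nonneg zero_le_power2)

text \<open>For a step of length d > 0, KL gives 1 <= \<psi>'(E) * b * d and the decrease is at
  least a * d^2, so their product bounds d by (b / a) * \<psi>'(E) times the decrease; concavity
  bounds that by the drop of (b / a) * \<psi>(E).\<close>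

lemma converges:
  assumes KL: "KL_with h (xb, 0) \<psi>" and acc: "strict_mono s" "(x \<circ> s) \<longlonglongrightarrow> xb"
  shows "x \<longlonglongrightarrow> xb" and "summable (\<lambda>k. norm (x (Suc k) - x k))"
    and "\<forall>\<^sub>F k in sequentially. norm (x k - xb) \<le> b / a * \<psi> (E k)"
proof -
  obtain e0 :: real and U \<psi>' where e0: "e0 > 0" and U: "open U" "(xb, 0) \<in> U"
    and conc: "concave_on {0..<e0} \<psi>" and cont: "continuous_on {0..<e0} \<psi>"
    and nonneg: "\<forall>t. 0 \<le> t \<and> t < e0 \<longrightarrow> 0 \<le> \<psi> t" and zero: "\<psi> 0 = 0"
    and D: "\<forall>t. 0 < t \<and> t < e0 \<longrightarrow> (\<psi> has_real_derivative \<psi>' t) (at t) \<and> 0 < \<psi>' t"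
    and ineq: "\<forall>y\<in>U. h (xb, 0) < h y \<and> h y < h (xb, 0) + e0 \<longrightarrow>
       1 \<le> \<psi>' (h y - h (xb, 0)) * norm (gradient h y)"
    using KL_with_realD[OF KL] by blast
  obtain \<delta> where \<delta>: "\<delta> > 0" "ball (xb, 0) \<delta> \<subseteq> U" using U by (meson open_contains_ball)
  have "\<forall>\<^sub>F k in sequentially. E k < e0" using E_lim e0 by (rule order_tendstoD)
  moreover have "\<forall>\<^sub>F k in sequentially. \<bar>e k\<bar> < \<delta> / 2"
    using tendstoD[OF e_lim, of "\<delta> / 2"] \<delta>(1) by simp
  moreover have "\<forall>\<^sub>F k in sequentially. (1::nat) \<le> k" by (rule eventually_ge_at_top)
  ultimately have "\<forall>\<^sub>F k in sequentially. E k < e0 \<and> \<bar>e k\<bar> < \<delta> / 2 \<and> 1 \<le> k"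
    by eventually_elim auto
  then obtain K where K: "\<And>k. K \<le> k \<Longrightarrow> E k < e0 \<and> \<bar>e k\<bar> < \<delta> / 2 \<and> 1 \<le> k"
    by (auto simp: eventually_at_top_linorder)
  define S where "S k = b / a * \<psi> (E k)" for k
  have step: "norm (x (Suc k) - x k) \<le> S k - S (Suc k)" if k: "K \<le> k" "dist (x k) xb < \<delta> / 2" for k
  proof -
    define d where "d = norm (x (Suc k) - x k)"
    have k1: "1 \<le> k" "0 < E k" "E k < e0" "0 < E (Suc k)" "E (Suc k) < e0"
      using K[of k] K[of "Suc k"] E_pos[of k] E_pos[of "Suc k"] k by auto
    have tang: "\<psi> (E k) - \<psi> (E (Suc k)) \<ge> \<psi>' (E k) * (E k - E (Suc k))"
      using k1 D by (intro concave_on_below_tangent[OF conc]) auto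
    have pos: "0 < \<psi>' (E k)" using k1 D by simp
    have "d \<le> b / a * (\<psi>' (E k) * (E k - E (Suc k)))"
    proof (cases "x (Suc k) = x k")
      \<comment> \<open>The right side is nonnegative because \<open>E\<close> is nonincreasing, so
        KL is invoked only where the gradient bound is available.\<close>
      case True
      thus ?thesis using a b pos E_Suc_le[OF k1(1)] by (simp add: d_def)
    next
      case False
      hence d: "d > 0" by (simp add: d_def)
      have "dist (x k, e k) (xb, 0) \<le> dist (x k) xb + \<bar>e k\<bar>"
        unfolding dist_Pair_Pair by (rule order_trans[OF sqrt_sum_squares_le_sum_abs]) simp
      also have "\<dots> < \<delta>" using k(2) K[OF k(1)] by simp
      finally have "(x k, e k) \<in> U" using \<delta>(2) by (auto simp: dist_commute)
      hence "1 \<le> \<psi>' (E k) * norm (gradient h (x k, e k))"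
        using ineq k1 E_def[of k] by force
      also have "\<dots> \<le> \<psi>' (E k) * (b * d)"
        using gradient_bound[OF k1(1) False] pos by (auto simp: d_def intro!: mult_left_mono)
      finally have "1 * (a * d) \<le> \<psi>' (E k) * (b * d) * (a * d)"
        using a d by (intro mult_right_mono) auto
      hence "a * d \<le> b * (\<psi>' (E k) * (a * d\<^sup>2))"
        by (simp add: power2_eq_square mult_ac)
      also have "\<dots> \<le> b * (\<psi>' (E k) * (E k - E (Suc k)))"
        using decrease[OF k1(1)] pos b by (intro mult_left_mono) (auto simp: d_def)
      finally show ?thesis using a by (simp add: field_simps)
    qed
    also have "\<dots> \<le> b / a * (\<psi> (E k) - \<psi> (E (Suc k)))"
      using tang a b by (intro mult_left_mono) auto
    finally show ?thesis by (simp add: S_def d_def right_diff_distrib)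
  qed
  have S_nonneg: "0 \<le> S k" if "K \<le> k" for k
    using nonneg K[OF that] E_pos[of k] a b by (simp add: S_def)
  \<comment> \<open>Continuity at 0 is one-sided and the filter omits 0, so \<open>E_pos\<close> is
    what lets \<open>E\<close> be composed with it.\<close>
  have "(\<psi> \<longlongrightarrow> \<psi> 0) (at 0 within {0..<e0})"
    using cont e0 by (simp add: continuous_on_def)
  moreover have "filterlim E (at 0 within {0..<e0}) sequentially"
    unfolding filterlim_at using E_lim
    by (auto intro!: eventually_sequentiallyI[of K] simp: less_imp_le) (use K E_pos in force)+
  ultimately have "(\<lambda>k. \<psi> (E k)) \<longlonglongrightarrow> 0"
    using filterlim_compose zero by metis
  hence S_lim: "S \<longlonglongrightarrow> 0" unfolding S_def by (rule tendsto_mult_right_zero)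
  obtain N where N: "K \<le> N" "\<And>k. N \<le> k \<Longrightarrow> norm (x (Suc k) - x k) \<le> S k - S (Suc k)"
    using telescoping_trap[OF step S_nonneg S_lim acc] \<delta>(1) by (metis half_gt_zero)
  note conv = telescoping_converges[OF N(2) S_nonneg[OF order_trans[OF N(1)]] S_lim acc]
  show "x \<longlonglongrightarrow> xb" "summable (\<lambda>k. norm (x (Suc k) - x k))"
    by (rule conv; assumption)+
  show "\<forall>\<^sub>F k in sequentially. norm (x k - xb) \<le> b / a * \<psi> (E k)"
    using conv(1) by (auto simp: S_def eventually_at_top_linorder)
qed

text \<open>Here \<psi>'(t) = M * (1 - q) * t^(-q), so KL reads E^q <= M * (1 - q) * b * d; squaring
  it and inserting d^2 into the decrease gives the recursion.\<close>

lemma powr_decrease: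
  assumes KL: "KL_with h (xb, 0) (\<lambda>t. M * t powr (1 - q))" and M: "M > 0" and q: "0 < q" "q < 1"
    and lim: "x \<longlonglongrightarrow> xb"
  obtains c where "c > 0"
    "\<forall>\<^sub>F k in sequentially. x (Suc k) \<noteq> x k \<longrightarrow> E (Suc k) \<le> E k - c * E k powr (2 * q)"
proof -
  obtain e0 :: real and U \<psi>' where e0: "e0 > 0" and U: "open U" "(xb, 0) \<in> U"
    and D: "\<forall>t. 0 < t \<and> t < e0 \<longrightarrow>
       ((\<lambda>t. M * t powr (1 - q)) has_real_derivative \<psi>' t) (at t) \<and> 0 < \<psi>' t"
    and ineq: "\<forall>y\<in>U. h (xb, 0) < h y \<and> h y < h (xb, 0) + e0 \<longrightarrow>
       1 \<le> \<psi>' (h y - h (xb, 0)) * norm (gradient h y)"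
    using KL_with_realD[OF KL] by blast
  \<comment> \<open>\<open>KL_with\<close> provides the derivative only as an existential witness;
    uniqueness of derivatives identifies it.\<close>
  have \<psi>': "\<psi>' t = M * (1 - q) * t powr (- q)" if "0 < t" "t < e0" for t
  proof (rule DERIV_unique)
    show "((\<lambda>t. M * t powr (1 - q)) has_real_derivative \<psi>' t) (at t)" using D that by blast
    show "((\<lambda>t. M * t powr (1 - q)) has_real_derivative M * (1 - q) * t powr (- q)) (at t)"
      using that by (auto intro!: derivative_eq_intros)
  qed
  have "(\<lambda>k. (x k, e k)) \<longlonglongrightarrow> (xb, 0)" by (intro tendsto_Pair lim e_lim)
  hence "\<forall>\<^sub>F k in sequentially. (x k, e k) \<in> U" by (rule topological_tendstoD[OF _ U])
  moreover have "\<forall>\<^sub>F k in sequentially. E k < e0" using E_lim e0 by (rule order_tendstoD)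
  moreover have "\<forall>\<^sub>F k in sequentially. (1::nat) \<le> k" by (rule eventually_ge_at_top)
  ultimately have "\<forall>\<^sub>F k in sequentially. x (Suc k) \<noteq> x k \<longrightarrow>
      E (Suc k) \<le> E k - a / (M * (1 - q) * b)\<^sup>2 * E k powr (2 * q)"
  proof eventually_elim
    case (elim k)
    show ?case
    proof
      assume nonnull: "x (Suc k) \<noteq> x k"
      define d where "d = norm (x (Suc k) - x k)"
      define B where "B = M * (1 - q) * b"
      have B: "B > 0" using M q b by (simp add: B_def)
      have Ek: "0 < E k" using E_pos elim by simp
      have "1 \<le> \<psi>' (E k) * norm (gradient h (x k, e k))"
        using ineq elim Ek E_def[of k] by force
      also have "\<dots> = M * (1 - q) * E k powr (- q) * norm (gradient h (x k, e k))"
        using \<psi>' Ek elim by simp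
      also have "\<dots> \<le> M * (1 - q) * E k powr (- q) * (b * d)"
        using gradient_bound[of k] nonnull elim M q by (auto simp: d_def intro!: mult_left_mono)
      finally have "E k powr q * 1 \<le> E k powr q * (B * d * E k powr (- q))"
        by (intro mult_left_mono) (auto simp: B_def mult_ac)
      also have "\<dots> = B * d * (E k powr q * E k powr (- q))" by simp
      also have "E k powr q * E k powr (- q) = 1"
        using Ek by (simp flip: powr_add)
      finally have "E k powr q \<le> B * d" by simp
      hence "(E k powr q)\<^sup>2 \<le> (B * d)\<^sup>2" by (intro power_mono) auto
      moreover have "(E k powr q)\<^sup>2 = E k powr (2 * q)"
        by (simp add: power2_eq_square flip: powr_add)
      ultimately have "E k powr (2 * q) / B\<^sup>2 \<le> d\<^sup>2"
        using B by (simp add: power_mult_distrib divide_le_eq mult.commute)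
      hence "a * (E k powr (2 * q) / B\<^sup>2) \<le> E k - E (Suc k)"
        using decrease[of k] a elim mult_left_mono[of "E k powr (2 * q) / B\<^sup>2" "d\<^sup>2" a]
        unfolding d_def by linarith
      thus "E (Suc k) \<le> E k - a / (M * (1 - q) * b)\<^sup>2 * E k powr (2 * q)"
        by (simp add: B_def)
    qed
  qed
  moreover have "a / (M * (1 - q) * b)\<^sup>2 > 0" using a b M q by simp
  ultimately show ?thesis using that by blast
qed

end

section \<open>Scalar recursions behind the convergence rates\<close>

lemma recursion_linear_rate:
  fixes S :: "nat \<Rightarrow> real"
  assumes S: "\<And>i. 0 < S i" "S \<longlonglongrightarrow> 0" and q: "0 < q" "q \<le> 1 / 2" and c: "c > 0"
    and rec: "\<forall>\<^sub>F i in sequentially. S (Suc i) \<le> S i - c * S i powr (2 * q)"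
  obtains C \<tau> where "C > 0" "0 < \<tau>" "\<tau> < 1" "\<forall>\<^sub>F i in sequentially. S i \<le> C * \<tau> ^ i"
proof -
  \<comment> \<open>The cap 1 / 2 keeps the ratio positive when c is large.\<close>
  define \<tau> where "\<tau> = 1 - min c (1 / 2)"
  have \<tau>: "0 < \<tau>" "\<tau> < 1" "1 - c \<le> \<tau>" using c by (auto simp: \<tau>_def)
  have "\<forall>\<^sub>F i in sequentially. S i < 1" using S(2) by (rule order_tendstoD) simp
  with rec have "\<forall>\<^sub>F i in sequentially. S (Suc i) \<le> \<tau> * S i"
  proof eventually_elim
    case (elim i)
    \<comment> \<open>Below 1 a smaller exponent gives a larger power, and 2 * q <= 1.\<close>
    have "S i powr 1 \<le> S i powr (2 * q)"
      using elim S(1)[of i] q by (intro powr_mono') auto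
    hence "c * S i \<le> c * S i powr (2 * q)" using S(1)[of i] c by simp
    hence "S (Suc i) \<le> (1 - c) * S i" using elim by (simp add: algebra_simps)
    also have "\<dots> \<le> \<tau> * S i" using \<tau>(3) S(1)[of i] by (intro mult_right_mono) auto
    finally show ?case .
  qed
  then obtain N where N: "\<And>i. N \<le> i \<Longrightarrow> S (Suc i) \<le> \<tau> * S i"
    by (auto simp: eventually_at_top_linorder)
  define C where "C = S N / \<tau> ^ N"
  have "S i \<le> C * \<tau> ^ i" if "N \<le> i" for i
    using that
  proof (induction i rule: dec_induct)
    case base
    show ?case using \<tau>(1) by (simp add: C_def)
  next
    case (step i)
    have "S (Suc i) \<le> \<tau> * S i" using N step by simp
    also have "\<dots> \<le> \<tau> * (C * \<tau> ^ i)" using step \<tau>(1) by (intro mult_left_mono) auto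
    finally show ?case by (simp add: mult_ac)
  qed
  moreover have "C > 0" using S(1) \<tau>(1) by (simp add: C_def)
  ultimately show ?thesis using \<tau> by (intro that[of C \<tau>]) (auto simp: eventually_at_top_linorder)
qed

text \<open>The power \<open>S i powr (- r)\<close> with r = 2 * q - 1 linearizes the recursion: by
  the Bernoulli-type bound (1 - u)^(-r) >= 1 + r * u it grows by at least r * c per step. Inverting
  linear growth gives the rate.\<close>

lemma recursion_sublinear_rate:
  fixes S :: "nat \<Rightarrow> real"
  assumes S: "\<And>i. 0 < S i" and q: "1 / 2 < q" and c: "c > 0"
    and rec: "\<forall>\<^sub>F i in sequentially. S (Suc i) \<le> S i - c * S i powr (2 * q)"
  obtains C where "C > 0" "\<forall>\<^sub>F i in sequentially. S i \<le> C * real i powr (- (1 / (2 * q - 1)))"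
proof -
  define r where "r = 2 * q - 1"
  have r: "r > 0" using q by (simp add: r_def)
  define V where "V i = S i powr (- r)" for i
  obtain N where N: "\<And>i. N \<le> i \<Longrightarrow> S (Suc i) \<le> S i - c * S i powr (2 * q)"
    using rec by (auto simp: eventually_at_top_linorder)
  have V_step: "V i + r * c \<le> V (Suc i)" if i: "N \<le> i" for i
  proof -
    define u where "u = c * S i powr r"
    have "S i powr (2 * q) = S i * S i powr r"
      using S[of i] powr_add[of "S i" 1 r] by (simp add: r_def)
    hence le: "S (Suc i) \<le> S i * (1 - u)" using N[OF i] by (simp add: u_def algebra_simps)
    hence "0 < S i * (1 - u)" using S[of "Suc i"] by simp
    \<comment> \<open>Positivity of the next term forces u < 1.\<close>
    hence u1: "0 < 1 - u" using S[of i] by (simp add: zero_less_mult_iff)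
    have "r * u \<le> - r * ln (1 - u)"
      using mult_left_mono[OF ln_le_minus_one[OF u1], of r] r by simp
    hence "exp (r * u) \<le> (1 - u) powr (- r)" using u1 by (simp add: powr_def)
    with exp_ge_add_one_self[of "r * u"] have 1: "1 + r * u \<le> (1 - u) powr (- r)" by linarith
    have "V i + r * c = V i * (1 + r * u)"
      using S[of i] by (simp add: V_def u_def algebra_simps flip: powr_add)
    also have "\<dots> \<le> V i * (1 - u) powr (- r)" by (intro mult_left_mono 1) (simp add: V_def)
    also have "\<dots> = (S i * (1 - u)) powr (- r)"
      using S[of i] u1 by (simp add: V_def powr_mult)
    also have "\<dots> \<le> V (Suc i)"
      unfolding V_def using le S[of "Suc i"] r by (intro powr_mono2') auto
    finally show ?thesis .
  qed
  have V_ge: "r * c * (real i - real N) \<le> V i" if "N \<le> i" for i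
    using that
  proof (induction i rule: dec_induct)
    case (step i)
    thus ?case using V_step[of i] by (simp add: algebra_simps)
  qed (simp add: V_def)
  define C where "C = (r * c / 2) powr (- (1 / r))"
  \<comment> \<open>From 2 * N on, i - N is at least i / 2; the extra 1 makes i positive.\<close>
  have "S i \<le> C * real i powr (- (1 / r))" if i: "2 * N + 1 \<le> i" for i
  proof -
    have "r * c / 2 * real i = r * c * (real i / 2)" by simp
    also have "\<dots> \<le> r * c * (real i - real N)" using i r c by (intro mult_left_mono) auto
    also have "\<dots> \<le> V i" using V_ge i by simp
    finally have "V i powr (- (1 / r)) \<le> (r * c / 2 * real i) powr (- (1 / r))"
      using r c i by (intro powr_mono2') auto
    moreover have "V i powr (- (1 / r)) = S i"
      using S[of i] r by (simp add: V_def powr_powr)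
    moreover have "(r * c / 2 * real i) powr (- (1 / r)) = C * real i powr (- (1 / r))"
      unfolding C_def by (rule powr_mult)
    ultimately show ?thesis by linarith
  qed
  moreover have "C > 0" using r c by (simp add: C_def)
  ultimately show ?thesis
    using that[of C] unfolding r_def eventually_at_top_linorder by blast
qed

subsection \<open>The forward-backward envelope\<close>

locale fb_setup = prox_setup g varrho lam
  for g :: "'a::euclidean_space \<Rightarrow> ereal" and varrho lam :: real +
  fixes f :: "'a \<Rightarrow> real" and L :: real
  assumes L_pos: "0 < L" and C2: "C2_smooth f" and lip: "L-lipschitz_on UNIV (gradient f)"
    and lam_L: "lam * (L + varrho) < 1"
begin

definition fb :: "'a \<Rightarrow> 'a" where "fb x = prx (fwd_step f lam x)"

definition envelope :: "'a \<Rightarrow> real" where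
  "envelope x = f x - lam / 2 * (norm (gradient f x))\<^sup>2 + moreau (fwd_step f lam x)"

lemma GDERIV_f: "GDERIV f x :> gradient f x"
  using C2 by (intro gderiv_gradient) (simp add: C2_smooth_def)

lemma gradient_lip: "norm (gradient f x - gradient f y) \<le> L * norm (x - y)"
  using lipschitz_onD[OF lip, of x y] by (simp add: dist_norm)

text \<open>Completing the square absorbs the linear term into the centre, so minimizing the model
  over y is a proximal problem at the forward step.\<close>

lemma quadratic_model_eq:
  "f x + gradient f x \<bullet> (y - x) + 1 / (2 * lam) * (norm (y - x))\<^sup>2 =
   f x - lam / 2 * (norm (gradient f x))\<^sup>2 + (norm (y - fwd_step f lam x))\<^sup>2 / (2 * lam)"
proof -
  have eq: "y - fwd_step f lam x = (y - x) + lam *\<^sub>R gradient f x" by (simp add: fwd_step_def)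
  have "(norm (y - fwd_step f lam x))\<^sup>2 =
      (norm (y - x))\<^sup>2 + 2 * lam * (gradient f x \<bullet> (y - x)) + lam\<^sup>2 * (norm (gradient f x))\<^sup>2"
    unfolding eq power2_norm_eq_inner
    by (simp add: inner_add_left inner_add_right inner_commute power2_eq_square)
  thus ?thesis using lam_pos by (simp add: field_simps power2_eq_square)
qed

lemma model_value:
  assumes "y \<in> dom"
  shows "f x + gradient f x \<bullet> (y - x) + 1 / (2 * lam) * (norm (y - x))\<^sup>2 + gr y =
    f x - lam / 2 * (norm (gradient f x))\<^sup>2 + obj (fwd_step f lam x) y"
  unfolding quadratic_model_eq obj_def by simp

lemma envelope_le_model:
  assumes "y \<in> dom"
  shows "envelope x \<le> f x + gradient f x \<bullet> (y - x) + 1 / (2 * lam) * (norm (y - x))\<^sup>2 + gr y"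
  unfolding model_value[OF assms] envelope_def moreau_def using prx_le[OF assms] by simp

lemma envelope_le: "x \<in> dom \<Longrightarrow> envelope x \<le> f x + gr x"
  using envelope_le_model[of x x] by simp

lemma fb_envelope_eq: "fb_envelope f g lam x = ereal (envelope x)"
proof -
  define m where
    "m y = ereal (f x + gradient f x \<bullet> (y - x) + 1 / (2 * lam) * (norm (y - x))\<^sup>2) + g y" for y
  have m: "m y = ereal (f x + gradient f x \<bullet> (y - x) + 1 / (2 * lam) * (norm (y - x))\<^sup>2 + gr y)"
    if "y \<in> dom" for y using that by (simp add: m_def g_eq)
  have "ereal (envelope x) \<le> m y" for y
  proof (cases "y \<in> dom")
    case True
    thus ?thesis using envelope_le_model m by simp
  qed (simp add: m_def g_notin)
  moreover have "m (fb x) = ereal (envelope x)"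
  proof -
    have d: "fb x \<in> dom" by (simp add: fb_def)
    show ?thesis unfolding m[OF d] model_value[OF d]
      by (simp add: envelope_def moreau_def fb_def)
  qed
  ultimately have "(INF y. m y) = ereal (envelope x)"
    by (intro antisym INF_greatest) (auto intro: INF_lower2[of "fb x"])
  thus ?thesis by (simp add: fb_envelope_def m_def)
qed

text \<open>The envelope at p is at most f + g there. The descent lemma puts this below the
  quadratic model at x by the stated multiple of the squared step, and p minimizes that model up to
  \<delta>.\<close>

lemma sufficient_decrease:
  assumes p: "prox_objective g lam (fwd_step f lam x) p \<le>
    (INF y. prox_objective g lam (fwd_step f lam x) y) + ereal \<delta>"
  shows "envelope p \<le> envelope x + \<delta> - (1 / (2 * lam) - L / 2) * (norm (p - x))\<^sup>2"
proof -
  note p' = inexact_prox_dist[OF p]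
  have "envelope p \<le> f p + gr p" by (rule envelope_le[OF p'(1)])
  also have "f p \<le> f x + gradient f x \<bullet> (p - x) + L / 2 * (norm (p - x))\<^sup>2"
    by (rule descent_lemma[OF GDERIV_f gradient_lip])
  finally have "envelope p \<le> (f x + gradient f x \<bullet> (p - x) + 1 / (2 * lam) * (norm (p - x))\<^sup>2 + gr p)
      - (1 / (2 * lam) - L / 2) * (norm (p - x))\<^sup>2"
    by (simp add: left_diff_distrib)
  also have "f x + gradient f x \<bullet> (p - x) + 1 / (2 * lam) * (norm (p - x))\<^sup>2 + gr p \<le> envelope x + \<delta>"
    unfolding model_value[OF p'(1)] using p'(2) by (simp add: envelope_def moreau_def)
  finally show ?thesis by simp
qed

text \<open>In the chain rule the terms with the gradient of f cancel, leaving the residual composed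
  with the identity minus \<open>lam\<close> times the second derivative of f, whose norm is at most
  \<open>1 + lam * L\<close>.\<close>

lemma envelope_derivative:
  obtains D where "(envelope has_derivative D) (at x)"
    "\<And>h. \<bar>D h\<bar> \<le> (1 + lam * L) / lam * norm (x - fb x) * norm h"
proof -
  obtain H :: "'a \<Rightarrow> 'a \<Rightarrow>\<^sub>L 'a" where
    "(gradient f has_derivative blinfun_apply (H x)) (at x)"
    using C2 by (auto simp: C2_smooth_def)
  then obtain A where A: "(gradient f has_derivative A) (at x)" by blast
  define u where "u = gradient f x"
  define D where "D h = ((h - lam *\<^sub>R A h) \<bullet> (x - fb x)) / lam" for h
  have f: "(f has_derivative (\<lambda>h. h \<bullet> u)) (at x)"
    using GDERIV_f by (simp add: gderiv_def u_def)
  have sq: "((\<lambda>x. (norm (gradient f x))\<^sup>2) has_derivative (\<lambda>h. 2 * (A h \<bullet> u))) (at x)"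
    unfolding power2_norm_eq_inner using has_derivative_inner[OF A A]
    by (simp add: u_def inner_commute)
  have fwd: "(fwd_step f lam has_derivative (\<lambda>h. h - lam *\<^sub>R A h)) (at x)"
    unfolding fwd_step_def by (intro derivative_intros A)
  have "(moreau has_derivative (\<lambda>h. h \<bullet> (1 / lam) *\<^sub>R (fwd_step f lam x - fb x))) (at (fwd_step f lam x))"
    using GDERIV_moreau by (simp add: gderiv_def fb_def)
  hence "((\<lambda>x. moreau (fwd_step f lam x)) has_derivative
      (\<lambda>h. (h - lam *\<^sub>R A h) \<bullet> (1 / lam) *\<^sub>R (fwd_step f lam x - fb x))) (at x)"
    by (rule has_derivative_compose[OF fwd])
  hence "(envelope has_derivative (\<lambda>h. h \<bullet> u - lam / 2 * (2 * (A h \<bullet> u)) +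
      (h - lam *\<^sub>R A h) \<bullet> (1 / lam) *\<^sub>R (fwd_step f lam x - fb x))) (at x)"
    unfolding envelope_def by (intro has_derivative_add has_derivative_diff f has_derivative_mult_right sq)
  moreover have "h \<bullet> u - lam / 2 * (2 * (A h \<bullet> u)) +
      (h - lam *\<^sub>R A h) \<bullet> (1 / lam) *\<^sub>R (fwd_step f lam x - fb x) = D h" for h
  proof -
    define v where "v = x - fb x"
    have "(1 / lam) *\<^sub>R (fwd_step f lam x - fb x) = (1 / lam) *\<^sub>R v - u"
      using lam_pos by (simp add: fwd_step_def v_def u_def scaleR_diff_right)
    thus ?thesis unfolding D_def v_def[symmetric] by (simp add: inner_diff_right inner_diff_left)
  qed
  ultimately have "(envelope has_derivative D) (at x)" by simp
  moreover have "\<bar>D h\<bar> \<le> (1 + lam * L) / lam * norm (x - fb x) * norm h" for h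
  proof -
    have "norm (h - lam *\<^sub>R A h) \<le> norm h + lam * norm (A h)"
      using norm_triangle_ineq4[of h "lam *\<^sub>R A h"] lam_pos by simp
    also have "lam * norm (A h) \<le> lam * (L * norm h)"
      using lam_pos by (intro mult_left_mono has_derivative_lipschitz_bound[OF A gradient_lip]) auto
    finally have "norm (h - lam *\<^sub>R A h) \<le> (1 + lam * L) * norm h"
      by (simp add: distrib_right)
    hence "\<bar>(h - lam *\<^sub>R A h) \<bullet> (x - fb x)\<bar> \<le> (1 + lam * L) * norm h * norm (x - fb x)"
      by (intro order_trans[OF Cauchy_Schwarz_ineq2] mult_right_mono) auto
    thus ?thesis using lam_pos by (simp add: D_def divide_right_mono mult_ac)
  qed
  ultimately show ?thesis using that by blast
qed

lemma isCont_envelope: "isCont envelope x"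
  by (rule envelope_derivative[of x]) (rule has_derivative_continuous)

lemma fb_tendsto:
  assumes "u \<longlonglongrightarrow> x"
  shows "(\<lambda>k. fb (u k)) \<longlonglongrightarrow> fb x"
proof -
  have "continuous_on UNIV (gradient f)" using lip by (rule lipschitz_on_continuous_on)
  hence "(\<lambda>k. gradient f (u k)) \<longlonglongrightarrow> gradient f x"
    by (rule continuous_on_tendsto_compose[OF _ assms]) auto
  hence F: "(\<lambda>k. fwd_step f lam (u k)) \<longlonglongrightarrow> fwd_step f lam x"
    unfolding fwd_step_def by (intro tendsto_intros assms)
  have "(\<lambda>k. norm (fwd_step f lam (u k) - fwd_step f lam x) / (lam * modulus)) \<longlonglongrightarrow>
      norm (fwd_step f lam x - fwd_step f lam x) / (lam * modulus)"
    by (intro tendsto_intros F) (use lam_pos modulus_pos in auto)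
  hence lim: "(\<lambda>k. norm (fwd_step f lam (u k) - fwd_step f lam x) / (lam * modulus)) \<longlonglongrightarrow> 0"
    by simp
  have "(\<lambda>k. fb (u k) - fb x) \<longlonglongrightarrow> 0"
    by (rule Lim_null_comparison[OF _ lim]) (unfold fb_def, intro always_eventually allI prx_lipschitz)
  thus ?thesis by (rule LIM_zero_cancel)
qed

text \<open>A fixed point minimizes its own quadratic model, so f + g falls at most quadratically
  around it. The difference quotients are then at least -K * |y - x|, which puts 0 in the Frechet
  subdifferential; constant sequences carry it to the limiting one.\<close>

lemma fb_fixed_point_stationary:
  assumes fixed: "fb x = x"
  shows "stationary_point (\<lambda>y. ereal (f y) + g y) x"
proof -
  \<comment> \<open>L / 2 comes from the descent lemma for -f, the rest from the quadratic of the
    model.\<close>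
  define K where "K = L / 2 + 1 / (2 * lam)"
  have x: "x \<in> dom" using prx_in_dom fixed by (metis fb_def)
  have lower: "f x + gr x - K * (norm (y - x))\<^sup>2 \<le> f y + gr y" if y: "y \<in> dom" for y
  proof -
    have "(f x - lam / 2 * (norm (gradient f x))\<^sup>2) + obj (fwd_step f lam x) x \<le>
        (f x - lam / 2 * (norm (gradient f x))\<^sup>2) + obj (fwd_step f lam x) y"
      using prx_le[OF y, of "fwd_step f lam x"] fixed by (simp add: fb_def)
    hence "f x + gr x \<le> f x + gradient f x \<bullet> (y - x) + 1 / (2 * lam) * (norm (y - x))\<^sup>2 + gr y"
      using model_value[OF x, of x] model_value[OF y, of x] by simp
    moreover have "- f y \<le> - f x + - gradient f x \<bullet> (y - x) + L / 2 * (norm (y - x))\<^sup>2"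
      by (rule descent_lemma) (use gradient_lip in \<open>auto intro: GDERIV_minus GDERIV_f simp: norm_minus_commute\<close>)
    ultimately show ?thesis by (simp add: K_def distrib_right)
  qed
  define \<phi> where "\<phi> y = ereal (f y) + g y" for y
  have \<phi>: "\<phi> y = ereal (f y + gr y)" if "y \<in> dom" for y using that by (simp add: \<phi>_def g_eq)
  define Q where "Q y = (\<phi> y - \<phi> x - ereal (0 \<bullet> (y - x))) / ereal (norm (y - x))" for y
  have "ereal (- K * norm (y - x)) \<le> Q y" if "y \<noteq> x" for y
  proof (cases "y \<in> dom")
    case True
    have "- K * norm (y - x) * norm (y - x) \<le> (f y + gr y) - (f x + gr x)"
      using lower[OF True] by (simp add: power2_eq_square)
    hence "- K * norm (y - x) \<le> ((f y + gr y) - (f x + gr x)) / norm (y - x)"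
      using that by (simp add: pos_le_divide_eq)
    thus ?thesis using that by (simp add: Q_def \<phi>[OF True] \<phi>[OF x])
  next
    case False
    hence "\<phi> y = \<infinity>" by (simp add: \<phi>_def g_notin)
    thus ?thesis using that by (simp add: Q_def \<phi>[OF x])
  qed
  hence "Liminf (at x) (\<lambda>y. ereal (- K * norm (y - x))) \<le> Liminf (at x) Q"
    by (intro Liminf_mono) (simp add: eventually_at_filter)
  moreover have "Liminf (at x) (\<lambda>y. ereal (- K * norm (y - x))) = 0"
  proof (rule lim_imp_Liminf)
    have "((\<lambda>y. - K * norm (y - x)) \<longlongrightarrow> - K * norm (x - x)) (at x)"
      by (intro tendsto_intros)
    thus "((\<lambda>y. ereal (- K * norm (y - x))) \<longlongrightarrow> 0) (at x)"
      by (simp add: zero_ereal_def)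
  qed simp
  ultimately have "0 \<le> Liminf (at x) Q" by simp
  moreover have "\<bar>\<phi> x\<bar> \<noteq> \<infinity>" using \<phi>[OF x] by simp
  ultimately have "0 \<in> frechet_subdiff \<phi> x"
    unfolding frechet_subdiff_def Q_def by blast
  hence "0 \<in> limiting_subdiff \<phi> x"
    unfolding limiting_subdiff_def using \<phi>[OF x]
    by (intro CollectI conjI exI[of _ "\<lambda>_. x"] exI[of _ "\<lambda>_. 0"]) auto
  thus ?thesis by (simp add: stationary_point_def \<phi>_def[abs_def])
qed

section \<open>The merit function and its gradient\<close>

abbreviation "C1 \<equiv> C1_const L varrho lam"
abbreviation "script_C \<equiv> script_C_const L varrho lam"
abbreviation "merit \<equiv> merit_fun f g L varrho lam"

lemma C1_pos: "C1 > 0"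
  using lam_pos lam_L by (simp add: C1_const_def)

lemma script_C_nonneg: "script_C \<ge> 0"
  using C1_pos lam_pos lam_varrho by (simp add: script_C_const_def)

lemma merit_eq: "merit (x, e) = envelope x + script_C * e\<^sup>2"
  by (simp add: merit_fun_def fb_envelope_eq)

lemma norm_gradient_merit_le:
  "norm (gradient merit (x, e)) \<le> (1 + lam * L) / lam * norm (x - fb x) + 2 * script_C * \<bar>e\<bar>"
proof -
  obtain D where D: "(envelope has_derivative D) (at x)"
    "\<And>h. \<bar>D h\<bar> \<le> (1 + lam * L) / lam * norm (x - fb x) * norm h"
    using envelope_derivative by blast
  have merit: "merit = (\<lambda>z. envelope (fst z) + script_C * (snd z)\<^sup>2)"
    by (auto simp: fun_eq_iff merit_eq)
  have fst: "(fst has_derivative fst) (at (x, e))"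
    by (rule has_derivative_fst[OF has_derivative_ident])
  have snd: "(snd has_derivative snd) (at (x, e))"
    by (rule has_derivative_snd[OF has_derivative_ident])
  have "((\<lambda>z. envelope (fst z)) has_derivative (\<lambda>h. D (fst h))) (at (x, e))"
    by (rule has_derivative_compose[OF fst]) (simp add: D)
  hence "(merit has_derivative (\<lambda>h. D (fst h) + script_C * (2 * e * snd h))) (at (x, e))"
    unfolding merit by (auto intro!: derivative_eq_intros snd)
  thus ?thesis
  proof (rule norm_gradient_le)
    fix h :: "'a \<times> real"
    have 1: "norm (fst h) \<le> norm h" "\<bar>snd h\<bar> \<le> norm h"
      using norm_fst_le[of "fst h" "snd h"] norm_snd_le[of "snd h" "fst h"] by auto
    have "\<bar>D (fst h) + script_C * (2 * e * snd h)\<bar> \<le>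
        (1 + lam * L) / lam * norm (x - fb x) * norm (fst h) + 2 * script_C * \<bar>e\<bar> * \<bar>snd h\<bar>"
      using D(2)[of "fst h"] script_C_nonneg
      by (intro order_trans[OF abs_triangle_ineq] add_mono) (auto simp: abs_mult)
    also have "\<dots> \<le> (1 + lam * L) / lam * norm (x - fb x) * norm h + 2 * script_C * \<bar>e\<bar> * norm h"
      using 1 script_C_nonneg lam_pos L_pos by (intro add_mono mult_left_mono) auto
    finally show "\<bar>D (fst h) + script_C * (2 * e * snd h)\<bar> \<le>
        ((1 + lam * L) / lam * norm (x - fb x) + 2 * script_C * \<bar>e\<bar>) * norm h"
      by (simp add: distrib_right)
  qed
qed

end

subsection \<open>The iterates\<close>

text \<open>The value at index 0 is arbitrary, so monotone convergence is applied to the shifted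
  sequence.\<close>

lemma convergent_if_eventually_decreasing:
  fixes u :: "nat \<Rightarrow> real"
  assumes "\<And>k. 1 \<le> k \<Longrightarrow> u (Suc k) \<le> u k" and "\<And>k. 1 \<le> k \<Longrightarrow> B \<le> u k"
  obtains l where "u \<longlonglongrightarrow> l" "B \<le> l"
proof -
  have "decseq (\<lambda>k. u (Suc k))" using assms(1) by (intro decseq_SucI) simp
  then obtain l where l: "(\<lambda>k. u (Suc k)) \<longlonglongrightarrow> l"
    using assms(2) decseq_convergent[of "\<lambda>k. u (Suc k)" B] by (metis Suc_eq_plus1_left le_add1)
  hence "B \<le> l" using assms(2) by (intro LIMSEQ_le_const) auto
  thus ?thesis using l that by (simp add: filterlim_sequentially_Suc)
qed

text \<open>The limit l exists by monotonicity; \<open>u (Suc k) - \<kappa> * u k\<close> tends to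
  (1 - \<kappa>) * l and vanishes infinitely often, hence l = 0.\<close>

lemma tendsto_zero_if_frequently_contracts:
  fixes u :: "nat \<Rightarrow> real"
  assumes dec: "\<And>k. 1 \<le> k \<Longrightarrow> u (Suc k) \<le> u k" and nonneg: "\<And>k. 1 \<le> k \<Longrightarrow> 0 \<le> u k"
    and "\<kappa> < 1" and contr: "\<exists>\<^sub>F k in sequentially. u (Suc k) = \<kappa> * u k"
  shows "u \<longlonglongrightarrow> 0"
proof -
  obtain l where l: "u \<longlonglongrightarrow> l" "0 \<le> l"
    using convergent_if_eventually_decreasing[of u 0, OF dec nonneg] .
  have lim: "(\<lambda>k. u (Suc k) - \<kappa> * u k) \<longlonglongrightarrow> l - \<kappa> * l"
    by (intro tendsto_intros LIMSEQ_Suc l)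
  have "l - \<kappa> * l = 0"
  proof (rule ccontr)
    assume "l - \<kappa> * l \<noteq> 0"
    hence "\<forall>\<^sub>F k in sequentially. u (Suc k) - \<kappa> * u k \<noteq> 0"
      by (rule tendsto_imp_eventually_ne[OF lim])
    hence "\<forall>\<^sub>F k in sequentially. \<not> (u (Suc k) = \<kappa> * u k)"
      by (rule eventually_mono) simp
    with contr show False by (simp add: frequently_def)
  qed
  hence "l * (1 - \<kappa>) = 0" by (simp add: algebra_simps)
  thus ?thesis using l(1) \<open>\<kappa> < 1\<close> by simp
qed

section \<open>The generated sequence: invariants, decrease and limits\<close>

locale fb_sequence = fb_setup g varrho lam f L
  for g :: "'a::euclidean_space \<Rightarrow> ereal" and varrho lam :: real and f :: "'a \<Rightarrow> real" and L :: real +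
  fixes \<mu> \<theta> :: real and rho \<epsilon> r :: "nat \<Rightarrow> real" and x p :: "nat \<Rightarrow> 'a"
    and xbar :: 'a and s :: "nat \<Rightarrow> nat"
  assumes \<mu>: "0 < \<mu>" "\<mu> < 1" and \<theta>: "0 < \<theta>" "\<theta> < 1" "\<theta> \<le> \<mu>"
    and init: "0 < \<epsilon> 1" "\<epsilon> 1 \<le> r 1"
    and alg: "inexact_prox_grad f g varrho lam \<mu> \<theta> rho x p \<epsilon> r"
    and rho: "\<And>k. 1 \<le> k \<Longrightarrow> rho k = C_const L varrho lam * (\<epsilon> k)\<^sup>2"
    and nonnull_infinite: "infinite ({1..} - null_iterations x)"
    and acc: "strict_mono s" "(x \<circ> s) \<longlonglongrightarrow> xbar"
begin

text \<open>This is the test performed by the method, whereas \<open>null_iterations\<close> looks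
  only at the iterates; \<open>null_step_iff\<close> reconciles the two.\<close>

definition null_step :: "nat \<Rightarrow> bool" where
  "null_step k \<longleftrightarrow> norm ((1 / lam) *\<^sub>R (x k - p k)) \<le> r k + \<epsilon> k"

lemma alg_prox:
  assumes "1 \<le> k"
  shows "prox_objective g lam (fwd_step f lam (x k)) (p k) \<le>
    (INF y. prox_objective g lam (fwd_step f lam (x k)) y) +
      ereal (min (lam * (1 - lam * varrho) * (\<epsilon> k)\<^sup>2 / 2) (rho k))"
  using alg assms unfolding inexact_prox_grad_def by blast

lemma alg_null:
  "1 \<le> k \<Longrightarrow> null_step k \<Longrightarrow> r (Suc k) = \<mu> * r k \<and> \<epsilon> (Suc k) = \<theta> * \<epsilon> k \<and> x (Suc k) = x k"
  and alg_nonnull: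
  "1 \<le> k \<Longrightarrow> \<not> null_step k \<Longrightarrow> r (Suc k) = r k \<and> \<epsilon> (Suc k) = \<epsilon> k \<and> x (Suc k) = p k"
  using alg unfolding inexact_prox_grad_def null_step_def by presburger+

lemma eps_pos_le: "1 \<le> k \<Longrightarrow> 0 < \<epsilon> k \<and> \<epsilon> k \<le> r k"
proof (induction k rule: dec_induct)
  case (step k)
  show ?case
  proof (cases "null_step k")
    case True
    have "\<theta> * \<epsilon> k \<le> \<mu> * r k" using step \<theta> \<mu> by (intro mult_mono) auto
    thus ?thesis using alg_null[OF _ True] step \<theta> by simp
  qed (use alg_nonnull step in auto)
qed (use init in auto)

lemma eps_Suc_le: "1 \<le> k \<Longrightarrow> \<epsilon> (Suc k) \<le> \<epsilon> k" and r_Suc_le: "1 \<le> k \<Longrightarrow> r (Suc k) \<le> r k"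
  using alg_null[of k] alg_nonnull[of k] eps_pos_le[of k] \<theta> \<mu>
  by (cases "null_step k"; simp add: mult_le_cancel_right1)+

text \<open>The first bound in the tolerance is exactly
  \<open>modulus / 2 * (lam * \<epsilon> k)\<^sup>2\<close>, which quadratic growth converts into
  this distance.\<close>

lemma prox_error: 
  assumes k: "1 \<le> k"
  shows "norm (p k - fb (x k)) \<le> lam * \<epsilon> k"
proof -
  have "modulus / 2 * (norm (p k - fb (x k)))\<^sup>2 \<le> lam * (1 - lam * varrho) * (\<epsilon> k)\<^sup>2 / 2"
    using inexact_prox_dist(3)[OF alg_prox[OF k]] by (simp add: fb_def)
  also have "\<dots> = modulus / 2 * (lam * \<epsilon> k)\<^sup>2"
    using lam_pos by (simp add: modulus_def field_simps power2_eq_square)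
  finally have "(norm (p k - fb (x k)))\<^sup>2 \<le> (lam * \<epsilon> k)\<^sup>2"
    using modulus_pos by simp
  thus ?thesis by (rule power2_le_imp_le) (use lam_pos eps_pos_le[OF k] in simp)
qed

lemma nonnull_step_length:
  assumes "1 \<le> k" "\<not> null_step k"
  shows "2 * lam * \<epsilon> k < norm (x (Suc k) - x k)"
proof -
  have "2 * \<epsilon> k < norm (x k - p k) / lam"
    using assms eps_pos_le[of k] lam_pos by (simp add: null_step_def)
  thus ?thesis using alg_nonnull[OF assms] lam_pos by (simp add: field_simps norm_minus_commute)
qed

lemma null_step_iff: "1 \<le> k \<Longrightarrow> null_step k \<longleftrightarrow> x (Suc k) = x k"
  using alg_null[of k] nonnull_step_length[of k] eps_pos_le[of k] lam_pos
  by (smt (verit, best) mult_pos_pos norm_zero right_minus_eq)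

text \<open>With residual norm (x k - p k) / lam, the merit function drops by at least C1 / 4 times
  the squared residual at non-null steps; the factor 1 / lam^2 passes to the step length.\<close>

definition a :: real where "a = C1 / (4 * lam\<^sup>2)"

text \<open>With step length d and 2 * lam * epsilon < d, the distance from x to T x is at most d +
  lam * epsilon <= 3 / 2 * d. The summand \<open>script_C\<close> is the derivative in epsilon,
  using 2 * epsilon <= d / lam.\<close>

definition b :: real where "b = (3 / 2 * (1 + lam * L) + script_C) / lam"

definition F :: "nat \<Rightarrow> real" where "F k = merit (x k, \<epsilon> k)"

lemma a_pos: "a > 0" using C1_pos lam_pos by (simp add: a_def)

lemma b_pos: "b > 0"
  using script_C_nonneg lam_pos L_pos by (simp add: b_def add_pos_nonneg)

text \<open>A null step only shrinks epsilon. Otherwise epsilon is unchanged, the descent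
  coefficient 1 / (2 * lam) - L / 2 is at least 2 * a, and the tolerance \<open>rho k\<close> costs
  at most a / 4 times the squared step.\<close>

lemma F_decrease:
  assumes k: "1 \<le> k"
  shows "a * (norm (x (Suc k) - x k))\<^sup>2 \<le> F k - F (Suc k)"
proof (cases "null_step k")
  case True
  have "(\<epsilon> (Suc k))\<^sup>2 \<le> (\<epsilon> k)\<^sup>2"
    using eps_Suc_le[OF k] eps_pos_le[of "Suc k"] by (intro power_mono) auto
  hence "script_C * (\<epsilon> (Suc k))\<^sup>2 \<le> script_C * (\<epsilon> k)\<^sup>2"
    using script_C_nonneg by (rule mult_left_mono)
  thus ?thesis using alg_null[OF k True] by (simp add: F_def merit_eq)
next
  case False
  define d where "d = norm (x (Suc k) - x k)"
  have nn: "x (Suc k) = p k" "\<epsilon> (Suc k) = \<epsilon> k" using alg_nonnull[OF k False] by auto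
  have "(2 * lam * \<epsilon> k)\<^sup>2 \<le> d\<^sup>2"
    using nonnull_step_length[OF k False] eps_pos_le[OF k] lam_pos unfolding d_def
    by (intro power_mono) auto
  hence eps: "(\<epsilon> k)\<^sup>2 \<le> d\<^sup>2 / (4 * lam\<^sup>2)"
    using lam_pos by (simp add: field_simps power_mult_distrib)
  have "rho k \<le> C1 / 4 * (\<epsilon> k)\<^sup>2"
    unfolding rho[OF k] C_const_def by (intro mult_right_mono) auto
  also have "\<dots> \<le> C1 / 4 * (d\<^sup>2 / (4 * lam\<^sup>2))"
    using C1_pos by (intro mult_left_mono eps) auto
  also have "\<dots> = a / 4 * d\<^sup>2" by (simp add: a_def)
  finally have rho_le: "rho k \<le> a / 4 * d\<^sup>2" .
  have "2 * a = (1 - lam * (L + varrho)) / (2 * lam)"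
    using lam_pos by (simp add: a_def C1_const_def field_simps power2_eq_square)
  also have "\<dots> \<le> (1 - lam * L) / (2 * lam)"
    using lam_pos varrho_nonneg by (intro divide_right_mono) (auto simp: distrib_left)
  also have "\<dots> = 1 / (2 * lam) - L / 2" using lam_pos by (simp add: field_simps)
  finally have "2 * a * d\<^sup>2 \<le> (1 / (2 * lam) - L / 2) * d\<^sup>2" by (intro mult_right_mono) auto
  moreover have "envelope (x (Suc k)) \<le> envelope (x k) + rho k - (1 / (2 * lam) - L / 2) * d\<^sup>2"
    using sufficient_decrease[OF alg_prox[OF k]] nn by (simp add: d_def)
  moreover have "0 \<le> a * d\<^sup>2" using a_pos by simp
  ultimately have "a * d\<^sup>2 \<le> envelope (x k) - envelope (x (Suc k))" using rho_le by linarith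
  thus ?thesis using nn by (simp add: F_def merit_eq d_def)
qed

lemma gradient_merit_bound:
  assumes k: "1 \<le> k" and "x (Suc k) \<noteq> x k"
  shows "norm (gradient merit (x k, \<epsilon> k)) \<le> b * norm (x (Suc k) - x k)"
proof -
  define d where "d = norm (x (Suc k) - x k)"
  have nn: "\<not> null_step k" using assms null_step_iff by blast
  have px: "x (Suc k) = p k" using alg_nonnull[OF k nn] by simp
  have eps: "2 * lam * \<epsilon> k < d" "0 < \<epsilon> k"
    using nonnull_step_length[OF k nn] eps_pos_le[OF k] by (auto simp: d_def)
  have "norm (x k - fb (x k)) \<le> norm (x k - p k) + norm (p k - fb (x k))"
    using norm_triangle_ineq[of "x k - p k" "p k - fb (x k)"] by simp
  also have "\<dots> \<le> d + lam * \<epsilon> k"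
    using prox_error[OF k] px by (simp add: d_def norm_minus_commute)
  finally have 1: "norm (x k - fb (x k)) \<le> 3 / 2 * d" using eps by linarith
  have 2: "2 * \<epsilon> k \<le> d / lam" using eps lam_pos by (simp add: field_simps)
  have "norm (gradient merit (x k, \<epsilon> k)) \<le>
      (1 + lam * L) / lam * norm (x k - fb (x k)) + script_C * (2 * \<epsilon> k)"
    using norm_gradient_merit_le[of "x k" "\<epsilon> k"] eps by simp
  also have "\<dots> \<le> (1 + lam * L) / lam * (3 / 2 * d) + script_C * (d / lam)"
    using 1 2 script_C_nonneg lam_pos L_pos by (intro add_mono mult_left_mono) auto
  also have "\<dots> = b * d" using lam_pos by (simp add: b_def field_simps)
  finally show ?thesis by (simp add: d_def)
qed

lemma F_antimono:
  assumes "1 \<le> i" "i \<le> j"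
  shows "F j \<le> F i"
  using assms(2)
proof (induction j rule: dec_induct)
  case (step n)
  have "0 \<le> a * (norm (x (Suc n) - x n))\<^sup>2" using a_pos by simp
  thus ?case using F_decrease[of n] step assms(1) by simp
qed simp

text \<open>F k dominates F, hence the envelope, at all later members of the subsequence. Passing
  through the envelope avoids the limit of \<open>\<epsilon>\<close>, which is not yet
  known.\<close>

lemma F_ge_limit:
  assumes k: "1 \<le> k"
  shows "envelope xbar \<le> F k"
proof -
  have "(\<lambda>i. envelope (x (s i))) \<longlonglongrightarrow> envelope xbar"
    using isCont_tendsto_compose[OF isCont_envelope acc(2)] by (simp add: o_def)
  moreover have "\<forall>\<^sub>F i in sequentially. envelope (x (s i)) \<le> F k"
  proof (rule eventually_sequentiallyI[of k])
    fix i assume "k \<le> i"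
    hence "k \<le> s i" using seq_suble[OF acc(1), of i] by simp
    hence "F (s i) \<le> F k" using k F_antimono by blast
    moreover have "envelope (x (s i)) \<le> F (s i)" using script_C_nonneg by (simp add: F_def merit_eq)
    ultimately show "envelope (x (s i)) \<le> F k" by simp
  qed
  ultimately show ?thesis by (rule tendsto_upperbound) simp
qed

lemma F_convergent: obtains l where "F \<longlonglongrightarrow> l"
proof (rule convergent_if_eventually_decreasing)
  show "F (Suc k) \<le> F k" if "1 \<le> k" for k using F_antimono that by simp
qed (use F_ge_limit that in auto)

lemma frequently_null_step: "\<exists>\<^sub>F k in sequentially. 1 \<le> k \<and> null_step k"
proof (rule ccontr)
  assume "\<not> ?thesis"
  hence "\<forall>\<^sub>F k in sequentially. \<not> (1 \<le> k \<and> null_step k)" by (simp add: not_frequently)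
  then obtain N where N: "\<And>k. N \<le> k \<Longrightarrow> \<not> (1 \<le> k \<and> null_step k)"
    by (auto simp: eventually_at_top_linorder)
  define N' where "N' = max 1 N"
  have nn: "1 \<le> k \<and> \<not> null_step k" if "N' \<le> k" for k using N[of k] that by (simp add: N'_def)
  have const: "\<epsilon> k = \<epsilon> N'" if "N' \<le> k" for k
    using that by (induction k rule: dec_induct) (use nn alg_nonnull in auto)
  have pos: "0 < a * (2 * lam * \<epsilon> N')\<^sup>2"
    using a_pos lam_pos eps_pos_le[of N'] by (simp add: N'_def)
  have drop: "a * (2 * lam * \<epsilon> N')\<^sup>2 \<le> F k - F (Suc k)" if "N' \<le> k" for k
  proof -
    have "(2 * lam * \<epsilon> N')\<^sup>2 \<le> (norm (x (Suc k) - x k))\<^sup>2"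
      using nonnull_step_length[of k] nn[OF that] const[OF that] eps_pos_le[of k] lam_pos
      by (intro power_mono) auto
    hence "a * (2 * lam * \<epsilon> N')\<^sup>2 \<le> a * (norm (x (Suc k) - x k))\<^sup>2"
      using a_pos by (intro mult_left_mono) auto
    thus ?thesis using F_decrease[of k] nn[OF that] by linarith
  qed
  obtain l where l: "F \<longlonglongrightarrow> l" by (rule F_convergent)
  have "(\<lambda>k. F k - F (Suc k)) \<longlonglongrightarrow> l - l" by (intro tendsto_diff l LIMSEQ_Suc)
  hence "a * (2 * lam * \<epsilon> N')\<^sup>2 \<le> l - l"
    by (rule LIMSEQ_le_const) (use drop in blast)
  thus False using pos by simp
qed

lemma eps_lim: "\<epsilon> \<longlonglongrightarrow> 0"
  by (rule tendsto_zero_if_frequently_contracts[of \<epsilon>, OF eps_Suc_le, where \<kappa> = \<theta>])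
     (use eps_pos_le \<theta> frequently_null_step alg_null in \<open>auto simp: less_imp_le elim: frequently_elim1\<close>)

lemma r_lim: "r \<longlonglongrightarrow> 0"
proof (rule tendsto_zero_if_frequently_contracts[of r, OF r_Suc_le, where \<kappa> = \<mu>])
  show "0 \<le> r k" if "1 \<le> k" for k using eps_pos_le[OF that] by simp
qed (use \<mu> frequently_null_step alg_null in \<open>auto elim: frequently_elim1\<close>)

lemma F_lim: "F \<longlonglongrightarrow> merit (xbar, 0)"
proof -
  obtain l where l: "F \<longlonglongrightarrow> l" by (rule F_convergent)
  have "(\<lambda>i. envelope (x (s i)) + script_C * (\<epsilon> (s i))\<^sup>2) \<longlonglongrightarrow> envelope xbar + script_C * 0\<^sup>2"
    using isCont_tendsto_compose[OF isCont_envelope acc(2)]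
      LIMSEQ_subseq_LIMSEQ[OF eps_lim acc(1)]
    by (intro tendsto_intros) (simp_all add: o_def)
  hence "(F \<circ> s) \<longlonglongrightarrow> merit (xbar, 0)" by (simp add: o_def F_def merit_eq)
  thus ?thesis using LIMSEQ_unique LIMSEQ_subseq_LIMSEQ[OF l acc(1)] l by blast
qed

text \<open>A later non-null step lowers F strictly, and even afterwards F is not below the limit.
  Strictness is what the KL inequality and negative powers of the gap require.\<close>

lemma F_greater_limit:
  assumes k: "1 \<le> k"
  shows "merit (xbar, 0) < F k"
proof -
  have "\<exists>j\<in>{1..} - null_iterations x. k < j"
    using nonnull_infinite infinite_nat_iff_unbounded by blast
  then obtain j where j: "k < j" "1 \<le> j" "x (Suc j) \<noteq> x j" by (auto simp: null_iterations_def)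
  have "0 < a * (norm (x (Suc j) - x j))\<^sup>2" using j a_pos by simp
  hence "F (Suc j) < F j" using F_decrease[OF j(2)] by linarith
  moreover have "F j \<le> F k" using F_antimono k j by simp
  moreover have "merit (xbar, 0) \<le> F (Suc j)" using F_ge_limit[of "Suc j"] by (simp add: merit_eq)
  ultimately show ?thesis by simp
qed

sublocale KL_descent merit x \<epsilon> "\<lambda>k. F k - merit (xbar, 0)" xbar a b
proof
  show "(\<lambda>k. F k - merit (xbar, 0)) \<longlonglongrightarrow> 0" using F_lim by (rule LIM_zero)
qed (use F_greater_limit eps_lim a_pos b_pos F_decrease gradient_merit_bound in \<open>auto simp: F_def\<close>)

text \<open>At null iterations the test and \<open>prox_error\<close> together give |x - T x| <= lam
  * (r + 2 * epsilon). These occur infinitely often, so the limit of the difference of the two sides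
  cannot be positive.\<close>

lemma limit_stationary:
  assumes "x \<longlonglongrightarrow> xbar"
  shows "stationary_point (\<lambda>y. ereal (f y) + g y) xbar"
proof (rule fb_fixed_point_stationary)
  have lim: "(\<lambda>k. norm (x k - fb (x k)) - lam * (r k + 2 * \<epsilon> k)) \<longlonglongrightarrow>
      norm (xbar - fb xbar) - lam * (0 + 2 * 0)"
    by (intro tendsto_intros assms fb_tendsto r_lim eps_lim)
  have freq: "\<exists>\<^sub>F k in sequentially. norm (x k - fb (x k)) - lam * (r k + 2 * \<epsilon> k) \<le> 0"
    using frequently_null_step
  proof (rule frequently_elim1)
    fix k assume k: "1 \<le> k \<and> null_step k"
    hence "norm (x k - p k) / lam \<le> r k + \<epsilon> k"
      using lam_pos by (simp add: null_step_def)
    hence "norm (x k - p k) \<le> lam * (r k + \<epsilon> k)"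
      using lam_pos by (simp add: pos_divide_le_eq mult.commute)
    moreover have "norm (p k - fb (x k)) \<le> lam * \<epsilon> k" using prox_error k by simp
    moreover have "norm (x k - fb (x k)) \<le> norm (x k - p k) + norm (p k - fb (x k))"
      using norm_triangle_ineq[of "x k - p k" "p k - fb (x k)"] by simp
    ultimately show "norm (x k - fb (x k)) - lam * (r k + 2 * \<epsilon> k) \<le> 0"
      by (simp add: algebra_simps)
  qed
  have "\<not> 0 < norm (xbar - fb xbar)"
  proof
    assume "0 < norm (xbar - fb xbar)"
    hence "\<forall>\<^sub>F k in sequentially. 0 < norm (x k - fb (x k)) - lam * (r k + 2 * \<epsilon> k)"
      using order_tendstoD(1)[OF lim, of 0] by simp
    hence "\<forall>\<^sub>F k in sequentially. \<not> (norm (x k - fb (x k)) - lam * (r k + 2 * \<epsilon> k) \<le> 0)"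
      by (rule eventually_mono) simp
    with freq show False by (simp add: frequently_def)
  qed
  thus "fb xbar = xbar" by simp
qed

section \<open>Rates along the non-null iterations\<close>

definition nonnull_index :: "nat \<Rightarrow> nat" where
  "nonnull_index k = enumerate ({1..} - null_iterations x) (k - 1)"

lemma nonnull_index: "1 \<le> nonnull_index k" "x (Suc (nonnull_index k)) \<noteq> x (nonnull_index k)"
  using enumerate_in_set[OF nonnull_infinite, of "k - 1"]
  by (auto simp: nonnull_index_def null_iterations_def)

lemma nonnull_index_at_top: "filterlim nonnull_index at_top sequentially"
  unfolding filterlim_at_top
proof
  fix Z
  have "Z \<le> nonnull_index k" if "Suc Z \<le> k" for k
    using le_enumerate[OF nonnull_infinite, of "k - 1"] that by (simp add: nonnull_index_def)
  thus "\<forall>\<^sub>F k in sequentially. Z \<le> nonnull_index k" by (rule eventually_sequentiallyI)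
qed

text \<open>\<open>enumerate\<close> counts from 0 and the iterates from 1; the truncated
  \<open>k - 1\<close> makes indices 0 and 1 coincide, so strict growth starts at 1.\<close>

lemma nonnull_index_Suc: "1 \<le> k \<Longrightarrow> Suc (nonnull_index k) \<le> nonnull_index (Suc k)"
  using enumerate_step[OF nonnull_infinite, of "k - 1"] by (simp add: nonnull_index_def)

text \<open>Null iterations between consecutive non-null ones can only lower F, so the recursion for
  the gap passes to the subsequence. The distance bound from \<open>converges\<close> then raises
  the rate of the gap to the power 1 - q.\<close>

lemma nonnull_rates:
  assumes KL: "KL_with merit (xbar, 0) (\<lambda>t. M * t powr (1 - q))" and M: "M > 0"
    and q: "0 < q" "q < 1" 
  shows "q \<le> 1 / 2 \<Longrightarrow> converges_linearly (\<lambda>k. x (nonnull_index k)) xbar"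
    and "q > 1 / 2 \<Longrightarrow> \<exists>\<gamma>>0. \<forall>\<^sub>F k in sequentially.
      norm (x (nonnull_index k) - xbar) \<le> \<gamma> * real k powr (- ((1 - q) / (2 * q - 1)))"
proof -
  define S where "S k = F (nonnull_index k) - merit (xbar, 0)" for k
  have S_pos: "0 < S k" for k using F_greater_limit nonnull_index by (simp add: S_def)
  have S_lim: "S \<longlonglongrightarrow> 0"
    unfolding S_def by (rule filterlim_compose[OF E_lim nonnull_index_at_top])
  define B where "B = b / a * M"
  have B: "B > 0" using a_pos b_pos M by (simp add: B_def)
  have "\<forall>\<^sub>F k in sequentially. norm (x k - xbar) \<le> b / a * (M * (F k - merit (xbar, 0)) powr (1 - q))"
    by (rule converges(3)[OF KL acc])
  hence "\<forall>\<^sub>F k in sequentially. norm (x (nonnull_index k) - xbar) \<le> b / a * (M * S k powr (1 - q))"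
    unfolding S_def by (rule eventually_compose_filterlim[OF _ nonnull_index_at_top])
  hence dist: "\<forall>\<^sub>F k in sequentially. norm (x (nonnull_index k) - xbar) \<le> B * S k powr (1 - q)"
    by (simp add: B_def mult_ac)
  obtain c where c: "c > 0" "\<forall>\<^sub>F k in sequentially. x (Suc k) \<noteq> x k \<longrightarrow>
      F (Suc k) - merit (xbar, 0) \<le> F k - merit (xbar, 0) - c * (F k - merit (xbar, 0)) powr (2 * q)"
    by (rule powr_decrease[OF KL M q converges(1)[OF KL acc]])
  have "\<forall>\<^sub>F k in sequentially. x (Suc (nonnull_index k)) \<noteq> x (nonnull_index k) \<longrightarrow>
      F (Suc (nonnull_index k)) - merit (xbar, 0) \<le> S k - c * S k powr (2 * q)"
    unfolding S_def by (rule eventually_compose_filterlim[OF c(2) nonnull_index_at_top])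
  moreover have "\<forall>\<^sub>F k in sequentially. (1::nat) \<le> k" by (rule eventually_ge_at_top)
  ultimately have rec: "\<forall>\<^sub>F k in sequentially. S (Suc k) \<le> S k - c * S k powr (2 * q)"
  proof eventually_elim
    case (elim k)
    have "F (nonnull_index (Suc k)) \<le> F (Suc (nonnull_index k))"
      using nonnull_index_Suc elim by (intro F_antimono) auto
    thus ?case using elim nonnull_index(2)[of k] by (simp add: S_def)
  qed
  show "converges_linearly (\<lambda>k. x (nonnull_index k)) xbar" if q_le: "q \<le> 1 / 2"
  proof -
    obtain C \<tau> where C: "C > 0" "0 < \<tau>" "\<tau> < 1" "\<forall>\<^sub>F i in sequentially. S i \<le> C * \<tau> ^ i"
      using recursion_linear_rate[OF S_pos S_lim q(1) q_le c(1) rec] .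
    have "\<forall>\<^sub>F k in sequentially. norm (x (nonnull_index k) - xbar) \<le>
        (B * C powr (1 - q)) * (\<tau> powr (1 - q)) ^ k"
      using dist C(4)
    proof eventually_elim
      case (elim k)
      have "S k powr (1 - q) \<le> (C * \<tau> ^ k) powr (1 - q)"
        using elim S_pos[of k] q by (intro powr_mono2) auto
      also have "\<dots> = C powr (1 - q) * (\<tau> powr (1 - q)) ^ k"
        using C by (simp add: powr_mult powr_powr mult.commute flip: powr_realpow)
      finally have "B * S k powr (1 - q) \<le> B * (C powr (1 - q) * (\<tau> powr (1 - q)) ^ k)"
        using B by (intro mult_left_mono) auto
      thus ?case using elim by (simp add: mult_ac)
    qed
    moreover have "\<tau> powr (1 - q) \<in> {0<..<1}"
      using C q powr_less_mono2[of "1 - q" \<tau> 1] by simp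
    moreover have "B * C powr (1 - q) > 0" using B C by simp
    ultimately show ?thesis unfolding converges_linearly_def by blast
  qed
  show "\<exists>\<gamma>>0. \<forall>\<^sub>F k in sequentially.
      norm (x (nonnull_index k) - xbar) \<le> \<gamma> * real k powr (- ((1 - q) / (2 * q - 1)))"
    if q_gt: "q > 1 / 2"
  proof -
    obtain C where C: "C > 0" "\<forall>\<^sub>F i in sequentially. S i \<le> C * real i powr (- (1 / (2 * q - 1)))"
      using recursion_sublinear_rate[OF S_pos q_gt c(1) rec] .
    have "\<forall>\<^sub>F k in sequentially. norm (x (nonnull_index k) - xbar) \<le>
        (B * C powr (1 - q)) * real k powr (- ((1 - q) / (2 * q - 1)))"
      using dist C(2)
    proof eventually_elim
      case (elim k)
      have "S k powr (1 - q) \<le> (C * real k powr (- (1 / (2 * q - 1)))) powr (1 - q)"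
        using elim S_pos[of k] q by (intro powr_mono2) auto
      also have "\<dots> = C powr (1 - q) * real k powr (- ((1 - q) / (2 * q - 1)))"
        by (simp add: powr_mult powr_powr)
      finally have "B * S k powr (1 - q) \<le> B * (C powr (1 - q) * real k powr (- ((1 - q) / (2 * q - 1))))"
        using B by (intro mult_left_mono) auto
      thus ?case using elim by (simp add: mult_ac)
    qed
    moreover have "B * C powr (1 - q) > 0" using B C by simp
    ultimately show ?thesis by blast
  qed
qed

end


theorem theorem3p22:
  fixes f :: "'a::euclidean_space \<Rightarrow> real" and g :: "'a \<Rightarrow> ereal"
    and L varrho lam \<mu> \<theta> :: real
    and rho \<epsilon> r :: "nat \<Rightarrow> real" and x p :: "nat \<Rightarrow> 'a" and xbar :: 'a
  assumes "L > 0" and "varrho \<ge> 0"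
    and "C2_smooth f" and "L-lipschitz_on UNIV (gradient f)"
    and "proper_fun g" and "lsc_fun g" and "weakly_convex varrho g"
    and "lam \<in> {0<..<1 / (L + varrho)}" and "\<mu> \<in> {0<..<1}" and "\<theta> \<in> {0<..<1}"
    and "\<epsilon> 1 > 0" and "r 1 > 0" and "\<forall>k\<ge>1. rho k \<ge> 0"
    and "inexact_prox_grad f g varrho lam \<mu> \<theta> rho x p \<epsilon> r"
    and "\<epsilon> 1 \<le> r 1" and "\<theta> \<le> \<mu>"
    and "\<forall>k\<ge>1. rho k = C_const L varrho lam * (\<epsilon> k)\<^sup>2"
    and "infinite ({1..} - null_iterations x)"
    and "\<exists>s. strict_mono s \<and> (x \<circ> s) \<longlonglongrightarrow> xbar"
    and "KL_property (merit_fun f g L varrho lam) (xbar, 0)"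
  shows "stationary_point (\<lambda>y. ereal (f y) + g y) xbar \<and>
         x \<longlonglongrightarrow> xbar \<and>
         (\<lambda>k. norm (x (k + 1) - x k)) summable_on {1..} \<and>
         (\<forall>M>0. \<forall>q\<in>{0<..<1}.
            KL_with (merit_fun f g L varrho lam) (xbar, 0) (\<lambda>t. M * t powr (1 - q)) \<longrightarrow>
            (let j = (\<lambda>k. enumerate ({1..} - null_iterations x) (k - 1));
                 z = (\<lambda>k. x (j k))
             in (q \<le> 1 / 2 \<longrightarrow> converges_linearly z xbar) \<and>
                (q > 1 / 2 \<longrightarrow>
                   (\<exists>\<gamma>>0. \<forall>\<^sub>F k in sequentially.
                      norm (z k - xbar) \<le> \<gamma> * real k powr (- ((1 - q) / (2 * q - 1)))))))"
proof -
  obtain s where s: "strict_mono s" "(x \<circ> s) \<longlonglongrightarrow> xbar" using assms(19) by blast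
  have lam: "0 < lam" "lam * (L + varrho) < 1"
    using assms(1,2,8) by (auto simp: field_simps)
  moreover have "lam * varrho < 1"
    using lam assms(1) by (simp add: distrib_left) (smt (verit) mult_pos_pos)
  ultimately interpret fb_sequence g varrho lam f L \<mu> \<theta> rho \<epsilon> r x p xbar s
    using assms s by unfold_locales auto
  obtain \<psi> where \<psi>: "KL_with merit (xbar, 0) \<psi>" using assms(20) by (auto simp: KL_property_def)
  note conv = converges(1,2)[OF \<psi> s]
  \<comment> \<open>Nonnegative terms make the convergent series unconditionally summable over all
    indices, and this restricts to those from 1 on.\<close>
  have "(\<lambda>k. norm (x (k + 1) - x k)) summable_on {1..}"
    by (rule summable_on_subset_banach[OF summable_nonneg_imp_summable_on])
       (use conv(2) in \<open>simp_all del: One_nat_def add: Suc_eq_plus1[symmetric]\<close>)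
  thus ?thesis
    using conv(1) limit_stationary[OF conv(1)] nonnull_rates
    by (auto simp: Let_def nonnull_index_def)
qed

end
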